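(* Let $G$ be a discrete group, $L\ge1$, and $\mathcal T\in\mathrm{Aut}(G)$ with $\mathcal T^L=\mathrm{id}$. For $g\in G$ and $j\in\mathbb Z/L\mathbb Z$ let $U_{g,j}$ be unitary $d\times d$ matrices with $U_{g,j}=U_{\mathcal T(g),j-1}$ and $U_{g,j}U_{h,j}=\nu_j(g,h)U_{gh,j}$, where $\nu_j$ is a $U(1)$-valued 2-cocycle on $G$ (so that $\nu_j(g,h)=\nu_{j-1}(\mathcal T(g),\mathcal T(h))$). Put $\mathcal U_g=\bigotimes_{j=1}^LU_{g,j}$. Suppose there is a left-canonical injective MPS tensor $A$ such that for all $g\in G$ and all positive integers $k$ the periodic MPS $|\psi_{kL}\rangle$ is an eigenstate of $\mathcal U_g^{\otimes k}$. For each $g\in G$ let $v_j(g)$, $0\le j\le L$, be bond unitaries with $v_0(g)\doteq v_L(g)$ and $U_{g,j}\cdot A\doteq v_{j-1}(g)^\dagger A v_j(g)$ for $1\le j\le L$. Then for each $j$ there is a $U(1)$-valued 2-cocycle $\omega_j$ with $v_j(g)v_j(h)=\omega_j(g,h)v_j(gh)$, and for $1\le j\le L$, up to coboundaries (i.e. as classes in $H^2(G,U(1))$), $$\omega_j(g,h)=\nu_j(g,h)\,\omega_{j-1}(g,h),\qquad \omega_j(g,h)=\omega_{j-1}(\mathcal T(g),\mathcal T(h)).$$ Consequently, if there are no classes $[\omega_0],\dots,[\omega_L]\in H^2(G,U(1))$ satisfying these two relations for all $1\le j\le L$, then no such injective MPS exists.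
   Context: An MPS tensor is a tuple $A=(A^s)_{s=1}^d$ of complex $\chi\times\chi$ matrices. The periodic MPS on $M$ sites is $|\psi_M\rangle=\sum_{s_1,\dots,s_M}\mathrm{Tr}(A^{s_1}\cdots A^{s_M})|s_1\dots s_M\rangle$. The transfer channel is $\mathcal E(X)=\sum_s (A^s)^\dagger X A^s$. Left-canonical injective means: $\mathcal E(\mathbb 1)=\mathbb 1$; there is a positive definite $\rho$ with $\mathrm{Tr}\,\rho=1$ and $\sum_s A^s\rho (A^s)^\dagger=\rho$; and $1$ is a simple eigenvalue of $\mathcal E$ with all other eigenvalues of modulus strictly less than $1$. $(U\cdot A)^s=\sum_{s'}U_{ss'}A^{s'}$. The symbol $\doteq$ denotes equality up to a phase (modulus-one scalar, independent of the physical index). "Eigenstate of $\mathcal U$" means $\mathcal U|\psi\rangle=e^{i\theta}|\psi\rangle$ for some real $\theta$. $G$ acts trivially on $U(1)$ in $H^2(G,U(1))$. Bond unitaries are unitary $\chi\times\chi$ matrices; unitaries $v_j(g)$ with the stated push-through property exist. *)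

theory Defs
  imports "HOL-Analysis.Analysis" "HOL-Algebra.Coset"
begin

subsection \<open>Complex matrices\<close>

definition cscale :: "complex \<Rightarrow> complex^'n^'m \<Rightarrow> complex^'n^'m"
  where "cscale c M = (\<chi> i j. c * M $ i $ j)"

definition adj :: "complex^'n^'m \<Rightarrow> complex^'m^'n"
  where "adj M = (\<chi> i j. cnj (M $ j $ i))"

definition unitary :: "complex^'n^'n \<Rightarrow> bool"
  where "unitary M \<longleftrightarrow> adj M ** M = mat 1 \<and> M ** adj M = mat 1"

definition positive_definite :: "complex^'n^'n \<Rightarrow> bool"
  where "positive_definite M \<longleftrightarrow> adj M = M \<and>
    (\<forall>x. x \<noteq> 0 \<longrightarrow> 0 < Re (\<Sum>i\<in>UNIV. cnj (x $ i) * (M *v x) $ i))"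

definition is_eigenvalue :: "(complex^'n^'n \<Rightarrow> complex^'n^'n) \<Rightarrow> complex \<Rightarrow> bool"
  where "is_eigenvalue F \<mu> \<longleftrightarrow> (\<exists>X. X \<noteq> 0 \<and> F X = cscale \<mu> X)"

text \<open>Simple means algebraic multiplicity one: the generalized eigenspace of \<open>\<mu>\<close>
  is a complex line.\<close>

definition simple_eigenvalue :: "(complex^'n^'n \<Rightarrow> complex^'n^'n) \<Rightarrow> complex \<Rightarrow> bool"
  where "simple_eigenvalue F \<mu> \<longleftrightarrow>
    (\<exists>X. X \<noteq> 0 \<and>
      {Y. \<exists>n. ((\<lambda>Z. F Z - cscale \<mu> Z) ^^ n) Y = 0} = range (\<lambda>c. cscale c X))"


subsection \<open>MPS tensors\<close>

text \<open>The finite types \<open>'d\<close> and \<open>'b\<close> index the physical space and the bond space.\<close>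

type_synonym ('d, 'b) mps = "'d \<Rightarrow> complex^'b^'b"

definition transfer :: "('d::finite, 'b::finite) mps \<Rightarrow> complex^'b^'b \<Rightarrow> complex^'b^'b"
  where "transfer A X = (\<Sum>s\<in>UNIV. adj (A s) ** X ** A s)"

definition left_canonical_injective :: "('d::finite, 'b::finite) mps \<Rightarrow> bool"
  where "left_canonical_injective A \<longleftrightarrow>
    transfer A (mat 1) = mat 1 \<and>
    (\<exists>\<rho>. positive_definite \<rho> \<and> trace \<rho> = 1 \<and>
      (\<Sum>s\<in>UNIV. A s ** \<rho> ** adj (A s)) = \<rho>) \<and>
    simple_eigenvalue (transfer A) 1 \<and>
    (\<forall>\<mu>. is_eigenvalue (transfer A) \<mu> \<and> \<mu> \<noteq> 1 \<longrightarrow> cmod \<mu> < 1)"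

definition phys_act :: "complex^'d^'d \<Rightarrow> ('d::finite, 'b::finite) mps \<Rightarrow> ('d, 'b) mps"
  where "phys_act V A = (\<lambda>s. \<Sum>s'\<in>UNIV. cscale (V $ s $ s') (A s'))"

definition phase_eq :: "complex^'n^'m \<Rightarrow> complex^'n^'m \<Rightarrow> bool"
  where "phase_eq X Y \<longleftrightarrow> (\<exists>c. cmod c = 1 \<and> X = cscale c Y)"

definition mps_phase_eq :: "('d, 'b::finite) mps \<Rightarrow> ('d, 'b) mps \<Rightarrow> bool"
  where "mps_phase_eq A B \<longleftrightarrow> (\<exists>c. cmod c = 1 \<and> (\<forall>s. A s = cscale c (B s)))"


subsection \<open>States on a finite chain\<close>

text \<open>A state on \<open>M\<close> sites is given by its amplitudes on the words of length \<open>M\<close>;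
  values on words of any other length carry no meaning.\<close>

definition mps_state :: "('d::finite, 'b::finite) mps \<Rightarrow> 'd list \<Rightarrow> complex"
  where "mps_state A w = trace (foldr (\<lambda>s X. A s ** X) w (mat 1))"

text \<open>The tensor product of a list of one-site operators, acting on states of
  \<open>length Vs\<close> sites.\<close>

definition tensor_op :: "(complex^'d^'d) list \<Rightarrow> ('d::finite list \<Rightarrow> complex) \<Rightarrow> 'd list \<Rightarrow> complex"
  where "tensor_op Vs \<psi> w =
    (\<Sum>u | length u = length Vs. (\<Prod>i<length Vs. (Vs ! i) $ (w ! i) $ (u ! i)) * \<psi> u)"

definition eigenstate :: "(complex^'d^'d) list \<Rightarrow> ('d::finite list \<Rightarrow> complex) \<Rightarrow> bool"
  where "eigenstate Vs \<psi> \<longleftrightarrow>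
    (\<exists>\<theta>::real. \<forall>w. length w = length Vs \<longrightarrow>
      tensor_op Vs \<psi> w = exp (\<i> * complex_of_real \<theta>) * \<psi> w)"

text \<open>The tensor factors of \<open>\<U>\<^sub>g\<close>, and the condition that the periodic MPS on \<open>k * L\<close> sites is
  an eigenstate of the \<open>k\<close>-th tensor power of \<open>\<U>\<^sub>g\<close> for all \<open>g\<close> and all positive \<open>k\<close>.\<close>

definition cell_factors :: "nat \<Rightarrow> ('g \<Rightarrow> int \<Rightarrow> complex^'d^'d) \<Rightarrow> 'g \<Rightarrow> (complex^'d^'d) list"
  where "cell_factors L U g = map (U g) [1..int L]"

definition symmetric_mps ::
    "('g, 'm) monoid_scheme \<Rightarrow> nat \<Rightarrow> ('g \<Rightarrow> int \<Rightarrow> complex^'d^'d) \<Rightarrow> ('d::finite, 'b::finite) mps \<Rightarrow> bool"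
  where "symmetric_mps G L U A \<longleftrightarrow>
    (\<forall>g\<in>carrier G. \<forall>k\<ge>1.
      eigenstate (concat (replicate k (cell_factors L U g))) (mps_state A))"

text \<open>Bond unitaries \<open>v\<^sub>j(g)\<close>, \<open>0 \<le> j \<le> L\<close>, with the push-through property.\<close>

definition bond_unitaries ::
    "('g, 'm) monoid_scheme \<Rightarrow> nat \<Rightarrow> ('g \<Rightarrow> int \<Rightarrow> complex^'d^'d) \<Rightarrow> ('d::finite, 'b::finite) mps
      \<Rightarrow> (int \<Rightarrow> 'g \<Rightarrow> complex^'b^'b) \<Rightarrow> bool"
  where "bond_unitaries G L U A v \<longleftrightarrow>
    (\<forall>g\<in>carrier G.
      (\<forall>j\<in>{0..int L}. unitary (v j g)) \<and>
      phase_eq (v 0 g) (v (int L) g) \<and>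
      (\<forall>j\<in>{1..int L}.
        mps_phase_eq (phys_act (U g j) A) (\<lambda>s. adj (v (j - 1) g) ** A s ** v j g)))"


subsection \<open>The second cohomology group with coefficients in \<open>U(1)\<close>\<close>

definition two_cocycle :: "('g, 'm) monoid_scheme \<Rightarrow> ('g \<times> 'g \<Rightarrow> complex) \<Rightarrow> bool"
  where "two_cocycle G \<omega> \<longleftrightarrow>
    (\<forall>g\<in>carrier G. \<forall>h\<in>carrier G. cmod (\<omega> (g, h)) = 1) \<and>
    (\<forall>g\<in>carrier G. \<forall>h\<in>carrier G. \<forall>k\<in>carrier G.
      \<omega> (g, h) * \<omega> (g \<otimes>\<^bsub>G\<^esub> h, k) = \<omega> (h, k) * \<omega> (g, h \<otimes>\<^bsub>G\<^esub> k))"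

definition two_coboundary :: "('g, 'm) monoid_scheme \<Rightarrow> ('g \<times> 'g \<Rightarrow> complex) \<Rightarrow> bool"
  where "two_coboundary G \<omega> \<longleftrightarrow>
    (\<exists>\<beta>. (\<forall>g\<in>carrier G. cmod (\<beta> g) = 1) \<and>
      (\<forall>g\<in>carrier G. \<forall>h\<in>carrier G. \<omega> (g, h) = \<beta> g * \<beta> h / \<beta> (g \<otimes>\<^bsub>G\<^esub> h)))"

text \<open>Cochains are made extensional (\<open>undefined\<close> off the carrier), so that equal cocycles on
  \<open>G\<close> are equal as functions and \<open>Z2\<close> is a group.\<close>

abbreviation res2 :: "('g, 'm) monoid_scheme \<Rightarrow> ('g \<times> 'g \<Rightarrow> complex) \<Rightarrow> 'g \<times> 'g \<Rightarrow> complex"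
  where "res2 G \<omega> \<equiv> restrict \<omega> (carrier G \<times> carrier G)"

definition Z2 :: "('g, 'm) monoid_scheme \<Rightarrow> ('g \<times> 'g \<Rightarrow> complex) monoid"
  where "Z2 G =
    \<lparr>carrier = {\<omega> \<in> extensional (carrier G \<times> carrier G). two_cocycle G \<omega>},
     mult = (\<lambda>\<omega> \<eta>. res2 G (\<lambda>p. \<omega> p * \<eta> p)),
     one = res2 G (\<lambda>_. 1)\<rparr>"

definition B2 :: "('g, 'm) monoid_scheme \<Rightarrow> ('g \<times> 'g \<Rightarrow> complex) set"
  where "B2 G = {\<omega> \<in> extensional (carrier G \<times> carrier G). two_coboundary G \<omega>}"

definition H2 :: "('g, 'm) monoid_scheme \<Rightarrow> ('g \<times> 'g \<Rightarrow> complex) set monoid"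
  where "H2 G = Z2 G Mod B2 G"

definition H2_class :: "('g, 'm) monoid_scheme \<Rightarrow> ('g \<times> 'g \<Rightarrow> complex) \<Rightarrow> ('g \<times> 'g \<Rightarrow> complex) set"
  where "H2_class G \<omega> = B2 G #>\<^bsub>Z2 G\<^esub> res2 G \<omega>"

definition pullback2 :: "('g \<Rightarrow> 'g) \<Rightarrow> ('g \<times> 'g \<Rightarrow> complex) \<Rightarrow> 'g \<times> 'g \<Rightarrow> complex"
  where "pullback2 T \<omega> = (\<lambda>(g, h). \<omega> (T g, T h))"

text \<open>The map induced on classes; all members of the union coincide
  (see \<open>H2_pullback_class\<close> below).\<close>

definition H2_pullback ::
    "('g, 'm) monoid_scheme \<Rightarrow> ('g \<Rightarrow> 'g) \<Rightarrow> ('g \<times> 'g \<Rightarrow> complex) set \<Rightarrow> ('g \<times> 'g \<Rightarrow> complex) set"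
  where "H2_pullback G T c = (\<Union>\<omega>\<in>c. H2_class G (pullback2 T \<omega>))"

lemma (in group) two_coboundary_imp_cocycle:
  assumes "two_coboundary G \<omega>"
  shows "two_cocycle G \<omega>"
proof -
  from assms obtain \<beta> where b: "\<And>g. g \<in> carrier G \<Longrightarrow> cmod (\<beta> g) = 1"
    and w: "\<And>g h. g \<in> carrier G \<Longrightarrow> h \<in> carrier G \<Longrightarrow> \<omega> (g, h) = \<beta> g * \<beta> h / \<beta> (g \<otimes> h)"
    unfolding two_coboundary_def by blast
  have nz: "\<beta> g \<noteq> 0" if "g \<in> carrier G" for g
    using b[OF that] by auto
  show ?thesis
    unfolding two_cocycle_def using b nz by (auto simp: w norm_mult norm_divide m_assoc)
qed

lemma (in group) two_cocycle_inverse: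
  "two_cocycle G \<omega> \<Longrightarrow> two_cocycle G (\<lambda>p. inverse (\<omega> p))"
  unfolding two_cocycle_def by (auto simp: norm_inverse simp flip: inverse_mult_distrib)

lemma (in group) two_cocycle_mult:
  assumes "two_cocycle G \<omega>" "two_cocycle G \<eta>"
  shows "two_cocycle G (\<lambda>p. \<omega> p * \<eta> p)"
  unfolding two_cocycle_def
proof (intro conjI ballI)
  fix g h k assume c: "g \<in> carrier G" "h \<in> carrier G" "k \<in> carrier G"
  have "\<omega> (g, h) * \<omega> (g \<otimes> h, k) = \<omega> (h, k) * \<omega> (g, h \<otimes> k)"
    "\<eta> (g, h) * \<eta> (g \<otimes> h, k) = \<eta> (h, k) * \<eta> (g, h \<otimes> k)"
    using assms c unfolding two_cocycle_def by auto
  then show "\<omega> (g, h) * \<eta> (g, h) * (\<omega> (g \<otimes> h, k) * \<eta> (g \<otimes> h, k)) =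
      \<omega> (h, k) * \<eta> (h, k) * (\<omega> (g, h \<otimes> k) * \<eta> (g, h \<otimes> k))"
    by algebra
qed (use assms in \<open>auto simp: two_cocycle_def norm_mult\<close>)

lemma (in group) two_cocycle_res2 [simp]: "two_cocycle G (res2 G \<omega>) \<longleftrightarrow> two_cocycle G \<omega>"
  unfolding two_cocycle_def by auto

lemma (in group) two_coboundary_res2 [simp]: "two_coboundary G (res2 G \<omega>) \<longleftrightarrow> two_coboundary G \<omega>"
  unfolding two_coboundary_def by auto

lemma (in group) comm_group_Z2: "comm_group (Z2 G)"
proof (rule comm_groupI)
  fix x assume x: "x \<in> carrier (Z2 G)"
  show "\<exists>y\<in>carrier (Z2 G). y \<otimes>\<^bsub>Z2 G\<^esub> x = \<one>\<^bsub>Z2 G\<^esub>"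
  proof (rule bexI)
    have "x p \<noteq> 0" if "p \<in> carrier G \<times> carrier G" for p
      using x that by (force simp: Z2_def two_cocycle_def)
    then show "res2 G (\<lambda>p. inverse (x p)) \<otimes>\<^bsub>Z2 G\<^esub> x = \<one>\<^bsub>Z2 G\<^esub>"
      by (auto simp: Z2_def restrict_def fun_eq_iff)
    show "res2 G (\<lambda>p. inverse (x p)) \<in> carrier (Z2 G)"
      using x two_cocycle_inverse by (auto simp: Z2_def)
  qed
  show "\<one>\<^bsub>Z2 G\<^esub> \<otimes>\<^bsub>Z2 G\<^esub> x = x"
    using x by (auto simp: Z2_def restrict_def fun_eq_iff extensional_def)
next
  show "\<one>\<^bsub>Z2 G\<^esub> \<in> carrier (Z2 G)"
    by (simp add: Z2_def two_cocycle_def)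
next
  fix x y assume "x \<in> carrier (Z2 G)" "y \<in> carrier (Z2 G)"
  then show "x \<otimes>\<^bsub>Z2 G\<^esub> y \<in> carrier (Z2 G)"
    by (simp add: Z2_def two_cocycle_mult)
qed (auto simp: Z2_def restrict_def fun_eq_iff mult_ac)

lemma (in group) subgroup_B2: "subgroup (B2 G) (Z2 G)"
proof -
  interpret Z: comm_group "Z2 G" by (rule comm_group_Z2)
  have nz: "x p \<noteq> 0" if "x \<in> carrier (Z2 G)" "p \<in> carrier G \<times> carrier G" for x p
    using that by (force simp: Z2_def two_cocycle_def)
  have BZ: "x \<in> carrier (Z2 G)" if "x \<in> B2 G" for x
    using that two_coboundary_imp_cocycle by (auto simp: B2_def Z2_def)
  show ?thesis
  proof (rule Z.subgroupI)
    show "B2 G \<subseteq> carrier (Z2 G)" using BZ by blast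
    have "res2 G (\<lambda>_. 1) \<in> B2 G"
      unfolding B2_def two_coboundary_def by (auto intro!: exI[of _ "\<lambda>_. 1"])
    then show "B2 G \<noteq> {}" by blast
  next
    fix x assume x: "x \<in> B2 G"
    then obtain \<beta> where b: "\<forall>g\<in>carrier G. cmod (\<beta> g) = 1"
      and w: "\<forall>g\<in>carrier G. \<forall>h\<in>carrier G. x (g, h) = \<beta> g * \<beta> h / \<beta> (g \<otimes> h)"
      unfolding B2_def two_coboundary_def by blast
    have "inv\<^bsub>Z2 G\<^esub> x = res2 G (\<lambda>p. inverse (x p))"
    proof (rule Z.inv_equality)
      show "res2 G (\<lambda>p. inverse (x p)) \<otimes>\<^bsub>Z2 G\<^esub> x = \<one>\<^bsub>Z2 G\<^esub>"
        using nz[OF BZ[OF x]] by (auto simp: Z2_def restrict_def fun_eq_iff)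
      show "res2 G (\<lambda>p. inverse (x p)) \<in> carrier (Z2 G)"
        using BZ[OF x] two_cocycle_inverse by (auto simp: Z2_def)
    qed (rule BZ[OF x])
    moreover have "two_coboundary G (\<lambda>p. inverse (x p))"
      unfolding two_coboundary_def using b w
      by (intro exI[of _ "\<lambda>g. inverse (\<beta> g)"]) (auto simp: norm_inverse norm_divide field_simps)
    ultimately show "inv\<^bsub>Z2 G\<^esub> x \<in> B2 G" by (simp add: B2_def)
  next
    fix x y assume x: "x \<in> B2 G" and y: "y \<in> B2 G"
    then obtain \<beta> \<gamma> where "\<forall>g\<in>carrier G. cmod (\<beta> g) = 1" "\<forall>g\<in>carrier G. cmod (\<gamma> g) = 1"
      "\<forall>g\<in>carrier G. \<forall>h\<in>carrier G. x (g, h) = \<beta> g * \<beta> h / \<beta> (g \<otimes> h)"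
      "\<forall>g\<in>carrier G. \<forall>h\<in>carrier G. y (g, h) = \<gamma> g * \<gamma> h / \<gamma> (g \<otimes> h)"
      unfolding B2_def two_coboundary_def by blast
    then have "two_coboundary G (\<lambda>p. x p * y p)"
      unfolding two_coboundary_def
      by (intro exI[of _ "\<lambda>g. \<beta> g * \<gamma> g"]) (auto simp: norm_mult)
    then show "x \<otimes>\<^bsub>Z2 G\<^esub> y \<in> B2 G" by (simp add: B2_def Z2_def)
  qed
qed

lemma (in group) comm_group_H2: "comm_group (H2 G)"
  unfolding H2_def by (rule comm_group.abelian_FactGroup[OF comm_group_Z2 subgroup_B2])

lemma (in group) H2_class_carrier: "two_cocycle G \<omega> \<Longrightarrow> H2_class G \<omega> \<in> carrier (H2 G)"
  unfolding H2_def H2_class_def carrier_FactGroup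
  by (rule imageI[of "res2 G \<omega>" "carrier (Z2 G)"]) (simp add: Z2_def)

lemma (in group) H2_class_mult:
  assumes "two_cocycle G \<omega>" "two_cocycle G \<eta>"
  shows "H2_class G \<omega> \<otimes>\<^bsub>H2 G\<^esub> H2_class G \<eta> = H2_class G (\<lambda>p. \<omega> p * \<eta> p)"
proof -
  interpret N: normal "B2 G" "Z2 G"
    by (rule comm_group.subgroup_imp_normal[OF comm_group_Z2 subgroup_B2])
  have "res2 G \<omega> \<otimes>\<^bsub>Z2 G\<^esub> res2 G \<eta> = res2 G (\<lambda>p. \<omega> p * \<eta> p)"
    by (auto simp: Z2_def restrict_def fun_eq_iff)
  with assms N.rcos_sum[of "res2 G \<omega>" "res2 G \<eta>"] show ?thesis
    by (simp add: H2_def H2_class_def) (simp add: Z2_def)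
qed

lemma (in group) H2_class_eq_iff:
  assumes "two_cocycle G \<omega>" "two_cocycle G \<eta>"
  shows "H2_class G \<omega> = H2_class G \<eta> \<longleftrightarrow> two_coboundary G (\<lambda>p. \<omega> p / \<eta> p)"
proof -
  interpret Z: comm_group "Z2 G" by (rule comm_group_Z2)
  have w: "res2 G \<omega> \<in> carrier (Z2 G)" and e: "res2 G \<eta> \<in> carrier (Z2 G)"
    using assms by (auto simp: Z2_def)
  have nz: "\<eta> p \<noteq> 0" if "p \<in> carrier G \<times> carrier G" for p
    using that assms by (force simp: two_cocycle_def)
  have *: "x \<otimes>\<^bsub>Z2 G\<^esub> res2 G \<eta> = res2 G \<omega> \<longleftrightarrow> x = res2 G (\<lambda>p. \<omega> p / \<eta> p)" if "x \<in> B2 G" for x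
  proof
    assume "x \<otimes>\<^bsub>Z2 G\<^esub> res2 G \<eta> = res2 G \<omega>"
    then have "x p * \<eta> p = \<omega> p" if "p \<in> carrier G \<times> carrier G" for p
      using that by (auto simp: Z2_def restrict_def fun_eq_iff split: if_splits)
    moreover have "x \<in> extensional (carrier G \<times> carrier G)"
      using \<open>x \<in> B2 G\<close> by (simp add: B2_def)
    ultimately show "x = res2 G (\<lambda>p. \<omega> p / \<eta> p)"
      using nz by (intro extensionalityI) (auto simp: field_simps)
  next
    assume "x = res2 G (\<lambda>p. \<omega> p / \<eta> p)"
    then show "x \<otimes>\<^bsub>Z2 G\<^esub> res2 G \<eta> = res2 G \<omega>"
      using nz by (auto simp: Z2_def restrict_def fun_eq_iff)
  qed
  have "H2_class G \<omega> = H2_class G \<eta> \<longleftrightarrow> res2 G \<omega> \<in> B2 G #>\<^bsub>Z2 G\<^esub> res2 G \<eta>"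
    unfolding H2_class_def
    using Z.repr_independence[OF _ e subgroup_B2] Z.rcos_self[OF w subgroup_B2] by auto
  also have "\<dots> \<longleftrightarrow> (\<exists>x\<in>B2 G. x \<otimes>\<^bsub>Z2 G\<^esub> res2 G \<eta> = res2 G \<omega>)"
    unfolding r_coset_def UN_iff singleton_iff by metis
  also have "\<dots> \<longleftrightarrow> res2 G (\<lambda>p. \<omega> p / \<eta> p) \<in> B2 G"
    using * by blast
  also have "\<dots> \<longleftrightarrow> two_coboundary G (\<lambda>p. \<omega> p / \<eta> p)"
    by (simp add: B2_def)
  finally show ?thesis .
qed

lemma (in group) two_cocycle_pullback:
  assumes "T \<in> hom G G" "two_cocycle G \<omega>"
  shows "two_cocycle G (pullback2 T \<omega>)"
  using assms hom_in_carrier[OF assms(1)]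
  by (auto simp: two_cocycle_def pullback2_def hom_mult)

lemma (in group) H2_pullback_class:
  assumes T: "T \<in> hom G G" and w: "two_cocycle G \<omega>"
  shows "H2_pullback G T (H2_class G \<omega>) = H2_class G (pullback2 T \<omega>)"
proof -
  interpret Z: comm_group "Z2 G" by (rule comm_group_Z2)
  have wZ: "res2 G \<omega> \<in> carrier (Z2 G)"
    using w by (simp add: Z2_def)
  have "H2_class G (pullback2 T \<eta>) = H2_class G (pullback2 T \<omega>)" if eta: "\<eta> \<in> H2_class G \<omega>" for \<eta>
  proof -
    have "\<eta> \<in> carrier (Z2 G)"
      using eta Z.r_coset_subset_G[OF subgroup.subset[OF subgroup_B2] wZ]
      by (auto simp: H2_class_def)
    then have "two_cocycle G \<eta>" and r: "res2 G \<eta> = \<eta>"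
      by (auto simp: Z2_def extensional_restrict)
    moreover have "H2_class G \<eta> = H2_class G \<omega>"
      using Z.repr_independence[OF eta[unfolded H2_class_def] wZ subgroup_B2]
      by (simp add: H2_class_def r)
    ultimately obtain \<beta> where b: "\<forall>g\<in>carrier G. cmod (\<beta> g) = 1"
      "\<forall>g\<in>carrier G. \<forall>h\<in>carrier G. \<eta> (g, h) / \<omega> (g, h) = \<beta> g * \<beta> h / \<beta> (g \<otimes> h)"
      using H2_class_eq_iff w unfolding two_coboundary_def by blast
    then have "two_coboundary G (\<lambda>p. pullback2 T \<eta> p / pullback2 T \<omega> p)"
      unfolding two_coboundary_def
      by (intro exI[of _ "\<lambda>g. \<beta> (T g)"])
        (use hom_in_carrier[OF T] hom_mult[OF T] in \<open>auto simp: pullback2_def\<close>)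
    with \<open>two_cocycle G \<eta>\<close> w T show ?thesis
      using H2_class_eq_iff two_cocycle_pullback by blast
  qed
  moreover have "res2 G \<omega> \<in> H2_class G \<omega>"
    unfolding H2_class_def by (rule Z.rcos_self[OF wZ subgroup_B2])
  ultimately show ?thesis
    unfolding H2_pullback_def by blast
qed

end

theory Submission
  imports Defs "HOL-Computational_Algebra.Fundamental_Theorem_Algebra"
begin

text \<open>
  Let \<open>E\<^sub>j X = (\<Sum>s. (A s)\<^sup>\<dagger> X (U\<^sub>g\<^sub>,\<^sub>j A) s)\<close>. The overlap of \<open>\<psi>\<^sub>k\<^sub>L\<close> with its image under \<open>\<U>\<^sub>g\<close> is
  the trace of the \<open>k\<close>-th power of \<open>E\<^sub>L \<circ> \<dots> \<circ> E\<^sub>1\<close>, and has the modulus of the trace of the \<open>kL\<close>-th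
  power of the transfer channel, which tends to \<open>1\<close>; hence the composition has an eigenvector \<open>X\<^sub>0\<close>
  with an eigenvalue of modulus at least \<open>1\<close>. In the norm \<open>tr (X \<rho> X\<^sup>\<dagger>)\<close> every \<open>E\<^sub>j\<close> is a contraction,
  with defect \<open>\<Sum>s. \<parallel>A s Y - X (U\<^sub>g\<^sub>,\<^sub>j A) s\<parallel>\<^sup>2\<close> for \<open>Y = E\<^sub>j X\<close>. So there is equality along the orbit
  \<open>X\<^sub>j = E\<^sub>j X\<^sub>j\<^sub>-\<^sub>1\<close>, that is \<open>A s X\<^sub>j = X\<^sub>j\<^sub>-\<^sub>1 (U\<^sub>g\<^sub>,\<^sub>j A) s\<close>; then the transfer channel maps
  \<open>X\<^sub>j\<^sub>-\<^sub>1\<^sup>\<dagger> X\<^sub>j\<^sub>-\<^sub>1\<close> to \<open>X\<^sub>j\<^sup>\<dagger> X\<^sub>j\<close>, which forces these to be the same scalar: the \<open>X\<^sub>j\<close> are bond unitaries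
  up to normalisation.

  Two families of bond unitaries that implement the same action differ by a cyclic intertwiner
  \<open>W\<^sub>j\<^sub>-\<^sub>1 A = c\<^sub>j A W\<^sub>j\<close>, \<open>W\<^sub>0 = c W\<^sub>L\<close>. Then \<open>W\<^sub>0\<close> is an eigenvector, with unimodular eigenvalue, of a
  power of the transfer channel, hence a scalar. Comparing \<open>v\<^sub>j(g) v\<^sub>j(h)\<close> with \<open>v\<^sub>j(gh)\<close>, and \<open>v\<^sub>j(g)\<close>
  with \<open>v\<^sub>j\<^sub>-\<^sub>1(T g)\<close>, gives the two relations.
\<close>

subsection \<open>Complex matrices\<close>

lemma cscale_nth [simp]: "cscale c M $ i $ j = c * M $ i $ j"
  by (simp add: cscale_def)

lemma adj_nth [simp]: "adj M $ i $ j = cnj (M $ j $ i)"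
  by (simp add: adj_def)

lemma cscale_cscale [simp]: "cscale a (cscale b M) = cscale (a * b) M"
  by (simp add: vec_eq_iff)

lemma cscale_one [simp]: "cscale 1 M = M"
  by (simp add: vec_eq_iff)

lemma cscale_zero_left [simp]: "cscale 0 M = 0"
  by (simp add: vec_eq_iff)

lemma cscale_zero_right [simp]: "cscale c 0 = 0"
  by (simp add: vec_eq_iff)

lemma cscale_add_left: "cscale (a + b) M = cscale a M + cscale b M"
  by (simp add: vec_eq_iff distrib_right)

lemma cscale_diff_left: "cscale (a - b) M = cscale a M - cscale b M"
  by (simp add: vec_eq_iff left_diff_distrib)

lemma cscale_diff_right: "cscale a (M - N) = cscale a M - cscale a N"
  by (simp add: vec_eq_iff right_diff_distrib)

lemma cscale_minus_left: "cscale (- a) M = - cscale a M"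
  by (simp add: vec_eq_iff)

lemma cscale_of_real: "cscale (of_real r) M = r *\<^sub>R M"
  by (simp add: vec_eq_iff scaleR_conv_of_real[where 'a=complex])

lemma cscale_sum_right: "cscale c (\<Sum>i\<in>S. f i) = (\<Sum>i\<in>S. cscale c (f i))"
  by (simp add: vec_eq_iff sum_distrib_left)

lemma cscale_sum_left: "cscale (\<Sum>i\<in>S. f i) M = (\<Sum>i\<in>S. cscale (f i) M)"
  by (simp add: vec_eq_iff sum_distrib_right)

lemma cscale_mult_left [simp]: "cscale c M ** N = cscale c (M ** N)"
  by (simp add: vec_eq_iff matrix_matrix_mult_def sum_distrib_left mult.assoc)

lemma cscale_mult_right [simp]: "M ** cscale c N = cscale c (M ** N)"
  by (simp add: vec_eq_iff matrix_matrix_mult_def sum_distrib_left mult.left_commute)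

lemma cscale_eq_0_iff [simp]: "cscale c M = 0 \<longleftrightarrow> c = 0 \<or> M = 0"
  by (auto simp: vec_eq_iff)

lemma cscale_cancel: "M \<noteq> 0 \<Longrightarrow> cscale a M = cscale b M \<longleftrightarrow> a = b"
  by (metis cscale_diff_left cscale_eq_0_iff eq_iff_diff_eq_0)

lemma adj_adj [simp]: "adj (adj M) = M"
  by (simp add: vec_eq_iff)

lemma adj_mat_1 [simp]: "adj (mat 1) = (mat 1 :: complex^'n^'n)"
  by (auto simp: vec_eq_iff mat_def)

lemma adj_cscale [simp]: "adj (cscale c M) = cscale (cnj c) (adj M)"
  by (simp add: vec_eq_iff)

lemma adj_mult: "adj (M ** N) = adj N ** adj M"
  by (simp add: vec_eq_iff matrix_matrix_mult_def mult.commute)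

lemma adj_diff: "adj (M - N) = adj M - adj N"
  by (simp add: vec_eq_iff)

lemma adj_sum: "adj (\<Sum>i\<in>S. f i) = (\<Sum>i\<in>S. adj (f i))"
  by (simp add: vec_eq_iff)

lemma matrix_mult_sum_left: "(\<Sum>i\<in>S. f i) ** (M :: complex^'n^'m) = (\<Sum>i\<in>S. f i ** M)"
  by (simp add: vec_eq_iff matrix_matrix_mult_def sum_distrib_right sum_distrib_left) (intro allI sum.swap)

lemma matrix_mult_sum_right: "(M :: complex^'n^'m) ** (\<Sum>i\<in>S. f i) = (\<Sum>i\<in>S. M ** f i)"
  by (induction S rule: infinite_finite_induct) (auto simp: matrix_add_ldistrib)

lemma matrix_add_rdistrib: "(B + C) ** (M :: complex^'n^'m) = B ** M + C ** M"
  by (simp add: vec_eq_iff matrix_matrix_mult_def distrib_right sum.distrib)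

lemma matrix_diff_ldistrib: "(M :: complex^'n^'m) ** (B - C) = M ** B - M ** C"
  by (simp add: vec_eq_iff matrix_matrix_mult_def right_diff_distrib sum_subtractf)

lemma matrix_diff_rdistrib: "(B - C) ** (M :: complex^'n^'m) = B ** M - C ** M"
  by (simp add: vec_eq_iff matrix_matrix_mult_def left_diff_distrib sum_subtractf)

lemma trace_cscale: "trace (cscale c M) = c * trace M"
  by (simp add: trace_def sum_distrib_left)

lemma trace_sum: "trace (\<Sum>i\<in>S. f i :: complex^'n^'n) = (\<Sum>i\<in>S. trace (f i))"
  by (simp add: trace_def) (rule sum.swap)

lemma norm_cscale: "norm (cscale c M) = cmod c * norm M"
proof -
  have "norm (cscale c M $ i) = cmod c * norm (M $ i)" for i
    by (simp add: norm_vec_def norm_mult L2_set_right_distrib)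
  then show ?thesis
    by (simp add: norm_vec_def[where 'a="complex^'a"] L2_set_right_distrib)
qed

lemma mat_1_neq_0: "(mat 1 :: complex^'n^'n) \<noteq> 0"
  by (auto simp: vec_eq_iff mat_def)

lemma cnj_mult_self_unit: "cmod c = 1 \<Longrightarrow> c * cnj c = 1"
  by (simp add: complex_mult_cnj cmod_def)

lemma unitary_mult:
  assumes "unitary M" "unitary N" shows "unitary (M ** N)"
proof -
  have "adj N ** (adj M ** M) ** N = mat 1" "M ** (N ** adj N) ** adj M = mat 1"
    using assms by (simp_all add: unitary_def)
  then show ?thesis by (simp add: unitary_def adj_mult matrix_mul_assoc)
qed

lemma unitary_adj: "unitary M \<Longrightarrow> unitary (adj M)"
  by (simp add: unitary_def)

lemma unitary_neq_0: "unitary M \<Longrightarrow> M \<noteq> 0"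
  using mat_1_neq_0 by (auto simp: unitary_def)

lemma unitary_scalar:
  assumes "unitary (cscale c (mat 1 :: complex^'n^'n))" shows "cmod c = 1"
proof -
  have "cscale (cnj c * c) (mat 1 :: complex^'n^'n) = cscale 1 (mat 1)"
    using assms by (simp add: unitary_def mult.commute)
  then have "cnj c * c = 1" by (simp add: cscale_cancel mat_1_neq_0 del: cscale_one)
  then have "cmod (cnj c * c) = 1" by simp
  then show ?thesis by (metis complex_mod_cnj norm_mult norm_one abs_norm_cancel abs_square_eq_1 power2_eq_square)
qed


subsection \<open>Powers of an operator with spectrum in the open unit disc\<close>

definition clinear_op :: "(complex^'n^'n \<Rightarrow> complex^'n^'n) \<Rightarrow> bool"
  where "clinear_op F \<longleftrightarrow>
    (\<forall>X Y. F (X + Y) = F X + F Y) \<and> (\<forall>c X. F (cscale c X) = cscale c (F X))"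

lemma
  assumes "clinear_op F"
  shows clinear_op_add: "F (X + Y) = F X + F Y"
    and clinear_op_cscale: "F (cscale c X) = cscale c (F X)"
    and clinear_op_0: "F 0 = 0"
    and clinear_op_diff: "F (X - Y) = F X - F Y"
    and clinear_op_sum: "F (\<Sum>i\<in>S. f i) = (\<Sum>i\<in>S. F (f i))"
proof -
  show *: "F (X + Y) = F X + F Y" "F (cscale c X) = cscale c (F X)" for X Y c
    using assms by (auto simp: clinear_op_def)
  show 0: "F 0 = 0" using *(2)[of 0 0] by simp
  show "F (X - Y) = F X - F Y"
    using *(1)[of "X - Y" Y] by (simp add: algebra_simps)
  show "F (\<Sum>i\<in>S. f i) = (\<Sum>i\<in>S. F (f i))"
    by (induction S rule: infinite_finite_induct) (auto simp: 0 *)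
qed

lemma clinear_op_funpow: "clinear_op F \<Longrightarrow> clinear_op (F ^^ k)"
  by (induction k) (auto simp: clinear_op_def)

text \<open>This is the vector \<open>p(F) X\<close>. The sum runs to an explicit bound
  \<open>N\<close> instead of \<open>degree p\<close>, so that bounds can be shifted by one without
  computing exact degrees.\<close>

definition poly_op :: "nat \<Rightarrow> complex poly \<Rightarrow> (complex^'n^'n \<Rightarrow> complex^'n^'n) \<Rightarrow> complex^'n^'n \<Rightarrow> complex^'n^'n"
  where "poly_op N p F X = (\<Sum>i\<le>N. cscale (coeff p i) ((F ^^ i) X))"

text \<open>Polynomials in \<open>F\<close> commute, so the factor \<open>F - \<mu>\<close> may be
  applied last or first. When the product annihilates \<open>X\<close>, the first form makes
  \<open>q(F) X\<close> an eigenvector unless it vanishes, and the second shows that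
  \<open>q\<close> annihilates \<open>F X - \<mu> X\<close>.\<close>

lemma poly_op_linear_factor:
  assumes F: "clinear_op F" and N: "degree q \<le> N"
  shows "poly_op (Suc N) ([:- \<mu>, 1:] * q) F X = F (poly_op N q F X) - cscale \<mu> (poly_op N q F X)"
    and "poly_op (Suc N) ([:- \<mu>, 1:] * q) F X = poly_op N q F (F X - cscale \<mu> X)"
proof -
  have c: "coeff ([:- \<mu>, 1:] * q) i = (case i of 0 \<Rightarrow> 0 | Suc j \<Rightarrow> coeff q j) - \<mu> * coeff q i" for i
    by (simp add: mult_pCons_left coeff_pCons split: nat.split)
  have "coeff q (Suc N) = 0" using N by (simp add: coeff_eq_0)
  then have s: "(\<Sum>i\<le>Suc N. cscale (\<mu> * coeff q i) ((F ^^ i) X)) = cscale \<mu> (poly_op N q F X)"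
    by (simp add: poly_op_def cscale_sum_right)
  have t: "(\<Sum>i\<le>Suc N. cscale (case i of 0 \<Rightarrow> 0 | Suc j \<Rightarrow> coeff q j) ((F ^^ i) X)) = F (poly_op N q F X)"
    by (subst sum.atMost_Suc_shift)
      (simp add: poly_op_def clinear_op_sum[OF F] clinear_op_cscale[OF F])
  show 1: "poly_op (Suc N) ([:- \<mu>, 1:] * q) F X = F (poly_op N q F X) - cscale \<mu> (poly_op N q F X)"
    unfolding poly_op_def[of "Suc N"] c cscale_diff_left sum_subtractf s t ..
  have "poly_op N q F (F X - cscale \<mu> X) = F (poly_op N q F X) - cscale \<mu> (poly_op N q F X)"
    using clinear_op_funpow[OF F]
    by (simp add: poly_op_def clinear_op_diff clinear_op_sum[OF F] clinear_op_cscale[OF F] cscale_diff_right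
        sum_subtractf cscale_sum_right clinear_op_cscale mult.commute funpow_swap1)
  then show "poly_op (Suc N) ([:- \<mu>, 1:] * q) F X = poly_op N q F (F X - cscale \<mu> X)"
    using 1 by simp
qed

text \<open>One iterate \<open>(F ^^ i) X\<close> more than the real dimension of the matrix space
  forces a real linear relation, whose coefficients are read as complex ones. Linear dependence
  speaks of sets, so coinciding iterates are treated separately, by a difference of
  monomials.\<close>

lemma annihilating_poly:
  fixes F :: "complex^'n^'n \<Rightarrow> complex^'n^'n"
  obtains p N where "p \<noteq> 0" "degree p \<le> N" "poly_op N p F X = 0"
proof (cases "inj_on (\<lambda>i. (F ^^ i) X) {..DIM(complex^'n^'n)}")
  case True
  define D where "D = DIM(complex^'n^'n)"
  define S where "S = (\<lambda>i. (F ^^ i) X) ` {..D}"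
  have inj: "inj_on (\<lambda>i. (F ^^ i) X) {..D}" using True by (simp only: D_def)
  have "card S = Suc D" unfolding S_def by (subst card_image[OF inj]) simp
  then have "dependent S"
    by (intro dependent_biggerset) (auto simp: S_def D_def)
  then obtain u v where u: "v \<in> S" "u v \<noteq> 0" "(\<Sum>v\<in>S. u v *\<^sub>R v) = 0"
    using dependent_finite[of S] by (auto simp: S_def)
  define a where "a i = complex_of_real (u ((F ^^ i) X))" for i
  define p where "p = Poly (map a [0..<Suc D])"
  have cp: "coeff p i = (if i \<le> D then a i else 0)" for i
    by (auto simp: p_def nth_default_def simp del: upt_Suc)
  show thesis
  proof
    show "poly_op D p F X = 0"
      using u(3) by (simp add: poly_op_def cp S_def sum.reindex[OF inj] a_def cscale_of_real)
    show "degree p \<le> D" by (rule degree_le) (simp add: cp)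
    obtain i where "i \<le> D" "v = (F ^^ i) X" using u(1) by (auto simp: S_def)
    then have "coeff p i \<noteq> 0" using u(2) by (simp add: cp a_def)
    then show "p \<noteq> 0" by auto
  qed
next
  case False
  then obtain i j where ij: "i < j" "(F ^^ i) X = (F ^^ j) X"
    unfolding inj_on_def by (metis nat_neq_iff)
  show thesis
  proof
    let ?p = "monom 1 j - monom 1 i :: complex poly"
    have "coeff ?p j \<noteq> 0" using ij by simp
    then show "?p \<noteq> 0" by (metis coeff_0)
    show "degree ?p \<le> j" using ij by (intro degree_le) auto
    have "poly_op j ?p F X = (\<Sum>k\<le>j. (if k = j then (F ^^ j) X else 0) - (if k = i then (F ^^ i) X else 0))"
      unfolding poly_op_def using ij(1) by (intro sum.cong) (auto simp: cscale_minus_left)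
    then show "poly_op j ?p F X = 0"
      using ij by (simp add: sum_subtractf)
  qed
qed

text \<open>Summing the recursion gives \<open>S \<le> a 0 + r * S + suminf b\<close> for every
  partial sum \<open>S\<close> of \<open>a\<close>; as \<open>r < 1\<close>, this bounds
  \<open>S\<close>.\<close>

lemma summable_perturbed_geometric:
  fixes a b :: "nat \<Rightarrow> real"
  assumes "\<And>k. a (Suc k) \<le> r * a k + b k" "\<And>k. 0 \<le> a k" "\<And>k. 0 \<le> b k"
    and "0 \<le> r" "r < 1" "summable b"
  shows "summable a"
proof (rule bounded_imp_summable)
  fix n
  have b: "sum b {..<n} \<le> suminf b"
    using assms by (intro sum_le_suminf) auto
  have "sum a {..n} = a 0 + (\<Sum>k<n. a (Suc k))"
    by (metis sum.lessThan_Suc_shift lessThan_Suc_atMost)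
  also have "\<dots> \<le> a 0 + (\<Sum>k<n. r * a k + b k)"
    using assms by (intro add_left_mono sum_mono) auto
  also have "\<dots> = a 0 + r * sum a {..<n} + sum b {..<n}"
    by (simp add: sum.distrib sum_distrib_left)
  also have "\<dots> \<le> a 0 + r * sum a {..n} + suminf b"
    using b assms by (intro add_mono mult_left_mono sum_mono2) auto
  finally show "sum a {..n} \<le> (a 0 + suminf b) / (1 - r)"
    using assms by (simp add: field_simps)
qed (use assms in auto)

text \<open>Induction on the degree of a polynomial annihilating \<open>X\<close>, splitting off one
  root at a time.\<close>

lemma summable_norm_powers:
  assumes F: "clinear_op F" and ev: "\<And>\<mu>. is_eigenvalue F \<mu> \<Longrightarrow> cmod \<mu> < 1"
  shows "summable (\<lambda>k. norm ((F ^^ k) X))"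
proof -
  have *: "summable (\<lambda>k. norm ((F ^^ k) X))"
    if "p \<noteq> 0" "degree p \<le> N" "poly_op N p F X = 0" for p N X
    using that
  proof (induction "degree p" arbitrary: p N X)
    case 0
    then obtain c where c: "p = [:c:]" "c \<noteq> 0" using degree_eq_zeroE by (metis pCons_0_0)
    have "poly_op N p F X = (\<Sum>i\<le>N. if i = 0 then cscale c X else 0)"
      unfolding poly_op_def c(1) by (intro sum.cong) (auto simp: coeff_pCons split: nat.split)
    then have "X = 0" using 0 c by simp
    moreover have "(F ^^ k) 0 = 0" for k using clinear_op_0[OF clinear_op_funpow[OF F]] .
    ultimately show ?case by simp
  next
    case (Suc n)
    then have "\<not> constant (poly p)" by (simp add: constant_degree)
    then obtain \<mu> where "poly p \<mu> = 0" using fundamental_theorem_of_algebra by blast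
    then obtain q where q: "p = [:- \<mu>, 1:] * q" by (auto simp: poly_eq_0_iff_dvd)
    with Suc.prems(1) have q0: "q \<noteq> 0" by auto
    have "degree p = Suc (degree q)"
      unfolding q using q0 by (subst degree_mult_eq) auto
    with Suc obtain M where dq: "n = degree q" and M: "N = Suc M" "degree q \<le> M"
      by (cases N) auto
    show ?case
    \<comment> \<open>For a root inside the disc, \<open>q\<close> annihilates
      \<open>F X - \<mu> X\<close>, and summability passes to \<open>X\<close> through a geometric
      recursion with ratio \<open>cmod \<mu>\<close>. Any other root is no eigenvalue, so
      \<open>q(F) X\<close> vanishes and \<open>q\<close> already annihilates
      \<open>X\<close>.\<close>
    proof (cases "cmod \<mu> < 1")
      case True
      let ?Y = "F X - cscale \<mu> X"
      have "summable (\<lambda>k. norm ((F ^^ k) ?Y))"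
        using Suc.prems(3) q0 dq M poly_op_linear_factor(2)[OF F M(2)]
        by (intro Suc.hyps(1)[of q M]) (auto simp: q)
      moreover have "norm ((F ^^ Suc k) X) \<le> cmod \<mu> * norm ((F ^^ k) X) + norm ((F ^^ k) ?Y)" for k
      proof -
        have "(F ^^ Suc k) X = cscale \<mu> ((F ^^ k) X) + (F ^^ k) ?Y"
          using clinear_op_funpow[OF F, of k]
          by (simp add: clinear_op_diff clinear_op_cscale funpow_swap1)
        then show ?thesis by (metis norm_cscale norm_triangle_ineq)
      qed
      ultimately show ?thesis using True
        by (intro summable_perturbed_geometric[of "\<lambda>k. norm ((F ^^ k) X)" "cmod \<mu>" "\<lambda>k. norm ((F ^^ k) ?Y)"]) simp_all
    next
      case False
      have "F (poly_op M q F X) = cscale \<mu> (poly_op M q F X)"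
        using Suc.prems(3) poly_op_linear_factor(1)[OF F M(2)] by (simp add: q M)
      then have "poly_op M q F X = 0"
        using False ev[of \<mu>] unfolding is_eigenvalue_def by blast
      then show ?thesis using q0 dq M by (intro Suc.hyps(1)[of q M]) auto
    qed
  qed
  show ?thesis by (rule annihilating_poly[of F X]) (rule *)
qed

lemma powers_tendsto_0:
  assumes "clinear_op F" "\<And>\<mu>. is_eigenvalue F \<mu> \<Longrightarrow> cmod \<mu> < 1"
  shows "(\<lambda>k. (F ^^ k) X) \<longlonglongrightarrow> 0"
  using summable_LIMSEQ_zero[OF summable_norm_powers[OF assms]] tendsto_norm_zero_iff by blast


subsection \<open>Transfer operators\<close>

definition mixed_transfer :: "('d::finite, 'b::finite) mps \<Rightarrow> ('d, 'b) mps \<Rightarrow> complex^'b^'b \<Rightarrow> complex^'b^'b"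
  where "mixed_transfer A B X = (\<Sum>s\<in>UNIV. adj (A s) ** X ** B s)"

lemma mixed_transfer_self: "mixed_transfer A A = transfer A"
  by (simp add: fun_eq_iff mixed_transfer_def transfer_def)

lemma clinear_mixed_transfer: "clinear_op (mixed_transfer A B)"
  by (simp add: clinear_op_def mixed_transfer_def matrix_add_ldistrib cscale_sum_right matrix_add_rdistrib
      sum.distrib)

lemma clinear_transfer: "clinear_op (transfer A)"
  using clinear_mixed_transfer[of A A] by (simp add: mixed_transfer_self)

lemma simple_eigenvalue_line:
  assumes "simple_eigenvalue F \<mu>" "X \<noteq> 0" "F X = cscale \<mu> X" "F Y = cscale \<mu> Y"
  shows "\<exists>c. Y = cscale c X"
proof -
  obtain Z where Z: "{Y. \<exists>n. ((\<lambda>Z. F Z - cscale \<mu> Z) ^^ n) Y = 0} = range (\<lambda>c. cscale c Z)"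
    using assms(1) unfolding simple_eigenvalue_def by blast
  have "W \<in> range (\<lambda>c. cscale c Z)" if "F W = cscale \<mu> W" for W
  proof -
    have "((\<lambda>Z. F Z - cscale \<mu> Z) ^^ 1) W = 0" using that by simp
    then show ?thesis unfolding Z[symmetric] by blast
  qed
  then obtain a b where ab: "X = cscale a Z" "Y = cscale b Z" using assms by blast
  then have "Y = cscale (b / a) X" using assms(2) by auto
  then show ?thesis ..
qed

lemma transfer_trace_dual:
  "trace (\<rho> ** transfer A X) = trace ((\<Sum>s\<in>UNIV. A s ** \<rho> ** adj (A s)) ** X)"
proof -
  have "trace (\<rho> ** (adj (A s) ** X ** A s)) = trace (A s ** \<rho> ** adj (A s) ** X)" for s
    using trace_mul_sym[of "\<rho> ** adj (A s) ** X" "A s"] by (simp add: matrix_mul_assoc)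
  then show ?thesis
    by (simp add: transfer_def matrix_mult_sum_left matrix_mult_sum_right trace_sum)
qed

text \<open>Left-canonical injectivity with the fixed point \<open>\<rho>\<close> named, so that all
  limits and weighted norms below refer to the same matrix.\<close>

locale canonical_mps =
  fixes A :: "('d::finite, 'b::finite) mps" and \<rho> :: "complex^'b^'b"
  assumes transfer_1: "transfer A (mat 1) = mat 1"
    and rho_pos: "positive_definite \<rho>"
    and trace_rho: "trace \<rho> = 1"
    and rho_fixed: "(\<Sum>s\<in>UNIV. A s ** \<rho> ** adj (A s)) = \<rho>"
    and simple: "simple_eigenvalue (transfer A) 1"
    and gap: "is_eigenvalue (transfer A) \<mu> \<Longrightarrow> \<mu> \<noteq> 1 \<Longrightarrow> cmod \<mu> < 1"
begin

lemma trace_transfer: "trace (\<rho> ** transfer A X) = trace (\<rho> ** X)"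
  by (simp add: transfer_trace_dual rho_fixed)

lemma trace_transfer_funpow: "trace (\<rho> ** (transfer A ^^ n) X) = trace (\<rho> ** X)"
  by (induction n) (simp_all add: trace_transfer)

lemma transfer_funpow_1: "(transfer A ^^ n) (mat 1) = mat 1"
  by (induction n) (simp_all add: transfer_1)

text \<open>Deflation: subtracting the rank-one spectral projection of the eigenvalue 1 leaves an
  operator whose spectrum lies in the open unit disc.\<close>

lemma transfer_powers_tendsto:
  "(\<lambda>n. (transfer A ^^ n) X) \<longlonglongrightarrow> cscale (trace (\<rho> ** X)) (mat 1)"
proof -
  define P where "P X = cscale (trace (\<rho> ** X)) (mat 1 :: complex^'b^'b)" for X
  define N where "N X = transfer A X - P X" for X
  have P: "clinear_op P"
    by (simp add: clinear_op_def P_def matrix_add_ldistrib trace_add cscale_add_left trace_cscale)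
  have N: "clinear_op N"
    using clinear_transfer[of A] P by (simp add: clinear_op_def N_def algebra_simps cscale_diff_right)
  have PP: "P (P X) = P X" for X
    by (simp add: P_def trace_cscale trace_rho)
  have EP: "transfer A (P X) = P X" for X
    by (simp add: P_def clinear_op_cscale[OF clinear_transfer] transfer_1)
  have PE: "P (transfer A X) = P X" for X
    by (simp add: P_def trace_transfer)
  have PN: "P (N X) = 0" for X
    by (simp add: N_def clinear_op_diff[OF P] PE PP)
  \<comment> \<open>An eigenvector of \<open>N\<close> outside the open disc lies in the kernel of
    \<open>P\<close>, hence is an eigenvector of the channel itself. The gap and simplicity make it
    a scalar matrix, which \<open>P\<close> fixes, so it would be zero.\<close>
  have ev: "cmod \<mu> < 1" if ev: "is_eigenvalue N \<mu>" for \<mu>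
  proof (rule ccontr)
    assume 1: "\<not> cmod \<mu> < 1"
    obtain X where X: "X \<noteq> 0" "N X = cscale \<mu> X" using ev unfolding is_eigenvalue_def by blast
    have "cscale \<mu> (P X) = 0"
      using PN[of X] by (simp add: X clinear_op_cscale[OF P])
    then have PX: "P X = 0" using 1 by auto
    then have EX: "transfer A X = cscale \<mu> X" using X by (simp add: N_def)
    then have "\<mu> = 1" using gap X 1 unfolding is_eigenvalue_def by blast
    then obtain c where "X = cscale c (mat 1)"
      using simple_eigenvalue_line[OF simple mat_1_neq_0, of X] EX transfer_1 by auto
    then have "P X = X" by (simp add: P_def trace_cscale trace_rho)
    then show False using PX X by simp
  qed
  \<comment> \<open>Only positive powers split this way: at power zero the right-hand side would be
    \<open>P X + X\<close>.\<close>
  have pow: "(transfer A ^^ Suc n) X = P X + (N ^^ Suc n) X" for n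
  proof (induction n)
    case 0 then show ?case by (simp add: N_def)
  next
    case (Suc n)
    have "(transfer A ^^ Suc (Suc n)) X = transfer A (P X) + transfer A ((N ^^ Suc n) X)"
      using Suc by (simp add: clinear_op_add[OF clinear_transfer])
    also have "transfer A ((N ^^ Suc n) X) = (N ^^ Suc (Suc n)) X"
      using PN[of "(N ^^ n) X"] by (simp add: N_def[of "N ((N ^^ n) X)"])
    finally show ?case by (simp add: EP)
  qed
  have "(\<lambda>n. P X + (N ^^ Suc n) X) \<longlonglongrightarrow> P X + 0"
    using LIMSEQ_Suc[OF powers_tendsto_0[OF N ev]] by (intro tendsto_intros)
  then have "(\<lambda>n. (transfer A ^^ Suc n) X) \<longlonglongrightarrow> P X"
    unfolding pow by simp
  then show ?thesis unfolding P_def by (rule LIMSEQ_imp_Suc)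
qed

text \<open>Along the multiples of \<open>n\<close> the iterates are constantly \<open>X\<close>,
  while they converge to a scalar matrix.\<close>

lemma transfer_funpow_fixed:
  assumes "0 < n" "(transfer A ^^ n) X = X"
  shows "X = cscale (trace (\<rho> ** X)) (mat 1)"
proof -
  have "((transfer A ^^ n) ^^ k) X = X" for k
    by (induction k) (simp_all add: assms)
  then have "(transfer A ^^ (n * k)) X = X" for k
    by (simp add: funpow_mult mult.commute)
  moreover have "(\<lambda>k. (transfer A ^^ (n * k)) X) \<longlonglongrightarrow> cscale (trace (\<rho> ** X)) (mat 1)"
    using transfer_powers_tendsto assms(1)
    by (intro filterlim_compose[OF transfer_powers_tendsto]) (auto intro!: filterlim_subseq strict_monoI)
  ultimately show ?thesis by (simp add: tendsto_const_iff)
qed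

text \<open>The channel preserves \<open>trace (\<rho> ** X)\<close>, so either \<open>c = 1\<close>
  or this trace is zero. In the second case the iterates tend to zero although their norms all equal
  \<open>norm X\<close>.\<close>

lemma transfer_funpow_phase:
  assumes n: "0 < n" and X: "X \<noteq> 0" "(transfer A ^^ n) X = cscale c X" and c: "cmod c = 1"
  shows "\<exists>t. X = cscale t (mat 1)"
proof -
  have "trace (\<rho> ** X) = c * trace (\<rho> ** X)"
    using trace_transfer_funpow[of n X] by (simp add: X trace_cscale)
  then consider "c = 1" | "trace (\<rho> ** X) = 0" by auto
  then show ?thesis
  proof cases
    case 1
    then show ?thesis using transfer_funpow_fixed[OF n, of X] X by auto
  next
    case 2
    have "((transfer A ^^ n) ^^ k) X = cscale (c ^ k) X" for k
      by (induction k) (simp_all add: X clinear_op_cscale[OF clinear_op_funpow[OF clinear_transfer]] mult.commute)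
    then have *: "(transfer A ^^ (n * k)) X = cscale (c ^ k) X" for k
      by (simp add: funpow_mult mult.commute)
    have "(\<lambda>k. (transfer A ^^ (n * k)) X) \<longlonglongrightarrow> cscale (trace (\<rho> ** X)) (mat 1)"
      using n by (intro filterlim_compose[OF transfer_powers_tendsto]) (auto intro!: filterlim_subseq strict_monoI)
    then have "(\<lambda>k. norm ((transfer A ^^ (n * k)) X)) \<longlonglongrightarrow> norm (0 :: complex^'b^'b)"
      using 2 by (intro tendsto_norm) simp
    then have "norm X = 0" by (simp add: * norm_cscale norm_power c LIMSEQ_const_iff)
    then show ?thesis using X by simp
  qed
qed

lemma A_nonzero: "\<exists>s. A s \<noteq> 0"
proof (rule ccontr)
  assume "\<nexists>s. A s \<noteq> 0"
  then have "transfer A (mat 1) = 0" by (simp add: transfer_def)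
  then show False using transfer_1 mat_1_neq_0[where 'n='b] by simp
qed

lemma isometry_sum: "(\<Sum>s\<in>UNIV. adj (A s) ** A s) = mat 1"
  using transfer_1 by (simp add: transfer_def)

lemma cyclic_intertwiner_scalar:
  fixes W :: "int \<Rightarrow> complex^'b^'b" and c :: "int \<Rightarrow> complex"
  assumes L: "1 \<le> L" and W0: "W 0 \<noteq> 0"
    and W: "\<And>j s. j \<in> {1..int L} \<Longrightarrow> W (j - 1) ** A s = cscale (c j) (A s ** W j)"
    and c: "\<And>j. j \<in> {1..int L} \<Longrightarrow> cmod (c j) = 1"
    and cyc: "W 0 = cscale a (W (int L))" "cmod a = 1"
    and j: "j \<in> {0..int L}"
  shows "\<exists>t. W j = cscale t (mat 1)"
proof -
  \<comment> \<open>Multiply the intertwining relation by \<open>adj (A s)\<close> from the left and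
    sum over \<open>s\<close>; left-canonicity removes the tensors on the right-hand side.\<close>
  have E: "transfer A (W (j - 1)) = cscale (c j) (W j)" if "j \<in> {1..int L}" for j
  proof -
    have "adj (A s) ** W (j - 1) ** A s = cscale (c j) (adj (A s) ** A s ** W j)" for s
      using W[OF that, of s] by (simp flip: matrix_mul_assoc)
    then show ?thesis
      by (simp add: transfer_def isometry_sum flip: cscale_sum_right matrix_mult_sum_left)
  qed
  have pow: "\<exists>b. cmod b = 1 \<and> (transfer A ^^ k) (W 0) = cscale b (W (int k))" if "k \<le> L" for k
    using that
  proof (induction k)
    case 0 then show ?case by (intro exI[of _ 1]) simp
  next
    case (Suc k)
    then obtain b where b: "cmod b = 1" "(transfer A ^^ k) (W 0) = cscale b (W (int k))" by auto
    have "transfer A (W (int k)) = cscale (c (int (Suc k))) (W (int (Suc k)))"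
      using E[of "int (Suc k)"] Suc.prems by simp
    then have "(transfer A ^^ Suc k) (W 0) = cscale (b * c (int (Suc k))) (W (int (Suc k)))"
      by (simp add: b clinear_op_cscale[OF clinear_transfer])
    moreover have "cmod (b * c (int (Suc k))) = 1"
      using b c[of "int (Suc k)"] Suc.prems by (simp add: norm_mult)
    ultimately show ?case by blast
  qed
  obtain b where b: "cmod b = 1" "(transfer A ^^ L) (W 0) = cscale b (W (int L))" using pow[of L] by auto
  have "a \<noteq> 0" using cyc by auto
  then have "(transfer A ^^ L) (W 0) = cscale (b / a) (W 0)" using b cyc by simp
  moreover have "cmod (b / a) = 1" using b cyc by (simp add: norm_divide)
  ultimately obtain t where t: "W 0 = cscale t (mat 1)"
    using transfer_funpow_phase[of L "W 0"] L W0 by auto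
  \<comment> \<open>The channel is unital, so the scalar \<open>W 0\<close> stays scalar at every
    later bond.\<close>
  obtain d where d: "cmod d = 1" "(transfer A ^^ nat j) (W 0) = cscale d (W j)"
    using pow[of "nat j"] j by (auto simp: nat_le_iff)
  then have "cscale d (W j) = cscale t (mat 1)"
    using t by (simp add: clinear_op_cscale[OF clinear_op_funpow[OF clinear_transfer]] transfer_funpow_1)
  then have "cscale (inverse d) (cscale d (W j)) = cscale (inverse d * t) (mat 1)" by simp
  moreover have "d \<noteq> 0" using d by auto
  ultimately have "W j = cscale (inverse d * t) (mat 1)" by simp
  then show ?thesis ..
qed

end

lemma left_canonical_injective_canonical_mps:
  "left_canonical_injective A \<longleftrightarrow> (\<exists>\<rho>. canonical_mps A \<rho>)"
  unfolding left_canonical_injective_def canonical_mps_def by blast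


subsection \<open>Overlaps of matrix product states\<close>

definition matrix_unit :: "'n \<Rightarrow> 'n \<Rightarrow> complex^'n^'n"
  where "matrix_unit i j = (\<chi> k l. if k = i \<and> l = j then 1 else 0)"

text \<open>The trace of \<open>F\<close> as a linear operator on the matrix space, taken in the
  basis of matrix units.\<close>

definition op_trace :: "(complex^'n^'n \<Rightarrow> complex^'n^'n) \<Rightarrow> complex"
  where "op_trace F = (\<Sum>i\<in>UNIV. \<Sum>j\<in>UNIV. F (matrix_unit i j) $ i $ j)"

lemma op_trace_sum: "op_trace (\<lambda>X. \<Sum>i\<in>S. F i X) = (\<Sum>i\<in>S. op_trace (F i))"
  unfolding op_trace_def by (simp add: sum.swap[where B=S])

text \<open>In the basis of matrix units the operator is a Kronecker product, so its trace factors.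
  This converts a product of two MPS amplitudes into an operator trace.\<close>

lemma op_trace_sandwich: "op_trace (\<lambda>X. adj P ** X ** Q) = cnj (trace P) * trace Q"
proof -
  have "(adj P ** matrix_unit i j) $ k $ l = (if l = j then cnj (P $ i $ k) else 0)" for i j k l
    by (simp add: matrix_matrix_mult_def matrix_unit_def if_distrib[where f="\<lambda>x. _ * x"] sum.If_cases
        cong: if_cong)
  then have "(adj P ** matrix_unit i j ** Q) $ i $ j = cnj (P $ i $ i) * Q $ j $ j" for i j
    by (simp add: matrix_matrix_mult_def[of _ Q] if_distrib[where f="\<lambda>x. x * _"] cong: if_cong)
  then show ?thesis
    by (simp add: op_trace_def trace_def sum_product)
qed

lemma tendsto_op_trace:
  "(\<And>X. (\<lambda>k. F k X) \<longlonglongrightarrow> G X) \<Longrightarrow> (\<lambda>k. op_trace (F k)) \<longlonglongrightarrow> op_trace G"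
  unfolding op_trace_def by (intro tendsto_intros)

text \<open>This operator is the limit of the powers of the transfer channel; with
  \<open>trace \<rho> = 1\<close> the squared norms of long periodic states tend to one.\<close>

lemma op_trace_rank_one: "op_trace (\<lambda>X. cscale (trace (\<rho> ** X)) (mat 1)) = trace \<rho>"
proof -
  have "(\<rho> ** matrix_unit i j) $ k $ l = (if l = j then \<rho> $ k $ i else 0)" for i j k l
    by (simp add: matrix_matrix_mult_def matrix_unit_def if_distrib[where f="\<lambda>x. _ * x"] sum.If_cases
        cong: if_cong)
  then have "trace (\<rho> ** matrix_unit i j) = \<rho> $ j $ i" for i j
    by (simp add: trace_def)
  then have "op_trace (\<lambda>X. cscale (trace (\<rho> ** X)) (mat 1)) = (\<Sum>i\<in>UNIV. \<Sum>j\<in>UNIV. if i = j then \<rho> $ j $ i else 0)"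
    unfolding op_trace_def by (intro sum.cong refl) (simp add: mat_def)
  then show ?thesis by (simp add: trace_def)
qed

lemma sum_lists_Suc:
  fixes f :: "'d::finite list \<Rightarrow> 'a::comm_monoid_add"
  shows "(\<Sum>w | length w = Suc n. f w) = (\<Sum>s\<in>UNIV. \<Sum>w | length w = n. f (s # w))"
proof -
  have "{w :: 'd list. length w = Suc n} = (\<lambda>(s, w). s # w) ` (UNIV \<times> {w. length w = n})"
    by (auto simp: length_Suc_conv image_iff)
  moreover have "inj_on (\<lambda>(s, w). s # w) (UNIV \<times> {w :: 'd list. length w = n})"
    by (auto simp: inj_on_def)
  ultimately show ?thesis
    by (simp add: sum.reindex sum.cartesian_product case_prod_unfold)
qed

text \<open>The tensor may vary from site to site, as needed after a physical operator has acted.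
  The last clause ends the recursion; the lemmas below evaluate lists of equal length.\<close>

fun word_prod :: "('d, 'b::finite) mps list \<Rightarrow> 'd list \<Rightarrow> complex^'b^'b"
  where "word_prod (B # Bs) (s # w) = B s ** word_prod Bs w"
  | "word_prod _ _ = mat 1"

lemma mps_state_word_prod: "mps_state A w = trace (word_prod (replicate (length w) A) w)"
proof -
  have "foldr (\<lambda>s X. A s ** X) w (mat 1) = word_prod (replicate (length w) A) w"
    by (induction w) auto
  then show ?thesis by (simp add: mps_state_def)
qed

text \<open>Distributivity, one site at a time: a product of sums over letters is a sum over words,
  weighted by the matrix elements of the tensor product.\<close>

lemma word_prod_phys_act:
  assumes "length w = length Vs"
  shows "word_prod (map (\<lambda>V. phys_act V A) Vs) w =
    (\<Sum>u | length u = length Vs. cscale (\<Prod>i<length Vs. (Vs ! i) $ (w ! i) $ (u ! i))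
      (word_prod (replicate (length u) A) u))"
  using assms
proof (induction Vs arbitrary: w)
  case Nil
  then show ?case by simp
next
  case (Cons V Vs)
  then obtain s v where w: "w = s # v" "length v = length Vs" by (cases w) auto
  let ?c = "\<lambda>u. \<Prod>i<length Vs. (Vs ! i) $ (v ! i) $ (u ! i)"
  let ?A = "\<lambda>u. word_prod (replicate (length u) A) u"
  have "word_prod (map (\<lambda>V. phys_act V A) (V # Vs)) w =
      (\<Sum>t\<in>UNIV. cscale (V $ s $ t) (A t)) ** (\<Sum>u | length u = length Vs. cscale (?c u) (?A u))"
    using Cons.IH[OF w(2)] by (simp add: w phys_act_def)
  also have "\<dots> = (\<Sum>t\<in>UNIV. \<Sum>u | length u = length Vs. cscale (V $ s $ t * ?c u) (?A (t # u)))"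
    by (subst sum.swap)
      (simp add: matrix_mult_sum_left matrix_mult_sum_right cscale_sum_right mult.commute)
  also have "\<dots> = (\<Sum>u | length u = length (V # Vs).
      cscale (\<Prod>i<length (V # Vs). ((V # Vs) ! i) $ (w ! i) $ (u ! i)) (?A u))"
    by (simp add: sum_lists_Suc w prod.lessThan_Suc_shift del: prod.lessThan_Suc)
  finally show ?case .
qed

lemma tensor_op_mps_state:
  assumes "length w = length Vs"
  shows "tensor_op Vs (mps_state A) w = trace (word_prod (map (\<lambda>V. phys_act V A) Vs) w)"
  by (simp add: tensor_op_def word_prod_phys_act[OF assms] trace_sum trace_cscale mps_state_word_prod)

text \<open>\<open>fold\<close> treats the head of the list first, so the first site ends up next to
  \<open>X\<close> on both sides, which is the order of the factors in \<open>word_prod\<close> and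
  in its adjoint.\<close>

lemma fold_mixed_transfer:
  "fold (mixed_transfer A) Bs X =
    (\<Sum>w | length w = length Bs. adj (word_prod (replicate (length w) A) w) ** X ** word_prod Bs w)"
proof (induction Bs arbitrary: X)
  case Nil
  then show ?case by simp
next
  case (Cons B Bs)
  have "fold (mixed_transfer A) (B # Bs) X =
      (\<Sum>w | length w = length Bs. \<Sum>s\<in>UNIV. adj (word_prod (replicate (length (s # w)) A) (s # w)) ** X **
        word_prod (B # Bs) (s # w))"
    by (simp add: Cons.IH mixed_transfer_def matrix_mult_sum_left matrix_mult_sum_right adj_mult matrix_mul_assoc)
  also have "\<dots> = (\<Sum>w | length w = length (B # Bs). adj (word_prod (replicate (length w) A) w) ** X **
      word_prod (B # Bs) w)"
    by (subst sum.swap) (simp add: sum_lists_Suc)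
  finally show ?case .
qed

lemma overlap_op_trace:
  "(\<Sum>w | length w = length Vs. cnj (mps_state A w) * tensor_op Vs (mps_state A) w) =
    op_trace (fold (mixed_transfer A) (map (\<lambda>V. phys_act V A) Vs))"
proof -
  have "fold (mixed_transfer A) (map (\<lambda>V. phys_act V A) Vs) =
    (\<lambda>X. \<Sum>w | length w = length Vs. adj (word_prod (replicate (length w) A) w) ** X **
      word_prod (map (\<lambda>V. phys_act V A) Vs) w)"
    by (rule ext) (simp add: fold_mixed_transfer)
  then show ?thesis
    by (simp add: op_trace_sum op_trace_sandwich tensor_op_mps_state mps_state_word_prod)
qed

lemma self_overlap_op_trace:
  "(\<Sum>w | length w = n. cnj (mps_state A w) * mps_state A w) = op_trace (transfer A ^^ n)"
proof -
  have "transfer A ^^ n = fold (mixed_transfer A) (replicate n A)"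
    by (induction n) (simp_all add: mixed_transfer_self funpow_Suc_right del: funpow.simps(2))
  moreover have "fold (mixed_transfer A) (replicate n A) =
    (\<lambda>X. \<Sum>w | length w = n. adj (word_prod (replicate (length w) A) w) ** X **
      word_prod (replicate n A) w)"
    by (rule ext, subst fold_mixed_transfer) simp
  ultimately show ?thesis
    by (simp add: op_trace_sum op_trace_sandwich mps_state_word_prod)
qed


subsection \<open>Existence of bond unitaries\<close>

lemma phase_eq_sym: "phase_eq X Y \<Longrightarrow> phase_eq Y X"
proof -
  assume "phase_eq X Y"
  then obtain c where c: "cmod c = 1" "X = cscale c Y" unfolding phase_eq_def by blast
  then have "c \<noteq> 0" by auto
  then show ?thesis
    unfolding phase_eq_def using c by (intro exI[of _ "inverse c"]) (simp add: norm_inverse)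
qed

lemma positive_definite_sandwich:
  fixes X :: "complex^'n^'n"
  assumes "positive_definite \<rho>"
  shows "0 \<le> Re (trace (X ** \<rho> ** adj X))"
    and "Re (trace (X ** \<rho> ** adj X)) = 0 \<Longrightarrow> X = 0"
proof -
  \<comment> \<open>The conjugated rows of \<open>X\<close>: the diagonal entries of
    \<open>X ** \<rho> ** adj X\<close> are the values of the quadratic form of
    \<open>\<rho>\<close> at these vectors.\<close>
  define y where "y i = (\<chi> j. cnj (X $ i $ j))" for i
  define f where "f i = Re (\<Sum>j\<in>UNIV. cnj (y i $ j) * (\<rho> *v y i) $ j)" for i
  have d: "(X ** \<rho> ** adj X) $ i $ i = (\<Sum>j\<in>UNIV. cnj (y i $ j) * (\<rho> *v y i) $ j)" for i
    unfolding matrix_matrix_mult_def matrix_vector_mult_def y_def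
    by (simp add: sum_distrib_left sum_distrib_right mult.assoc) (rule sum.swap)
  have q: "Re (trace (X ** \<rho> ** adj X)) = (\<Sum>i\<in>UNIV. f i)"
    by (simp only: trace_def d f_def Re_sum)
  have f: "0 \<le> f i" "f i = 0 \<Longrightarrow> y i = 0" for i
    using assms unfolding positive_definite_def f_def
    by (cases "y i = 0"; force)+
  show "0 \<le> Re (trace (X ** \<rho> ** adj X))"
    unfolding q using f by (intro sum_nonneg) auto
  assume "Re (trace (X ** \<rho> ** adj X)) = 0"
  then have "y i = 0" for i
    using f unfolding q by (subst (asm) sum_nonneg_eq_0_iff) auto
  then show "X = 0" by (simp add: vec_eq_iff y_def)
qed

lemma clinear_op_fold:
  "(\<And>B. B \<in> set Bs \<Longrightarrow> clinear_op (f B)) \<Longrightarrow> clinear_op (fold f Bs)"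
  by (induction Bs) (auto simp: clinear_op_def)

lemma fold_map_concat_replicate:
  "fold f (map g (concat (replicate k xs))) = fold f (map g xs) ^^ k"
  by (induction k) (simp_all add: funpow_Suc_right del: funpow.simps(2))

text \<open>The columns of \<open>V\<close> are orthonormal, so summing over \<open>s\<close> first
  leaves a Kronecker delta in \<open>t\<close> and \<open>u\<close>.\<close>

lemma unitary_sum_collapse:
  fixes V :: "complex^'d::finite^'d" and f :: "'d \<Rightarrow> 'd \<Rightarrow> complex^'n^'m"
  assumes "unitary V"
  shows "(\<Sum>s\<in>UNIV. \<Sum>t\<in>UNIV. \<Sum>u\<in>UNIV. cscale (cnj (V $ s $ t) * V $ s $ u) (f t u)) = (\<Sum>t\<in>UNIV. f t t)"
proof -
  have "(adj V ** V) $ t $ u = (mat 1 :: complex^'d^'d) $ t $ u" for t u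
    using assms by (simp add: unitary_def)
  then have d: "(\<Sum>s\<in>UNIV. cnj (V $ s $ t) * V $ s $ u) = (if t = u then 1 else 0)" for t u
    by (simp add: matrix_matrix_mult_def mat_def)
  have "(\<Sum>s\<in>UNIV. \<Sum>t\<in>UNIV. \<Sum>u\<in>UNIV. cscale (cnj (V $ s $ t) * V $ s $ u) (f t u)) =
      (\<Sum>t\<in>UNIV. \<Sum>u\<in>UNIV. \<Sum>s\<in>UNIV. cscale (cnj (V $ s $ t) * V $ s $ u) (f t u))"
    by (subst sum.swap) (intro sum.cong refl sum.swap)
  also have "\<dots> = (\<Sum>t\<in>UNIV. \<Sum>u\<in>UNIV. if t = u then f t u else 0)"
    by (intro sum.cong refl) (simp add: d flip: cscale_sum_left)
  finally show ?thesis by simp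
qed

text \<open>A unitary on the physical index changes the Kraus operators but not the channel they
  define.\<close>

lemma phys_act_transfer:
  assumes "unitary V"
  shows "transfer (phys_act V A) M = transfer A M"
proof -
  have "adj (phys_act V A s) ** M ** phys_act V A s =
    (\<Sum>t\<in>UNIV. \<Sum>u\<in>UNIV. cscale (cnj (V $ s $ t) * V $ s $ u) (adj (A t) ** M ** A u))" for s
    by (subst sum.swap)
      (simp add: phys_act_def adj_sum matrix_mult_sum_left matrix_mult_sum_right cscale_sum_right mult.commute)
  then show ?thesis
    by (simp add: transfer_def unitary_sum_collapse[OF assms])
qed

lemma phys_act_dual_transfer:
  assumes "unitary V"
  shows "(\<Sum>s\<in>UNIV. phys_act V A s ** M ** adj (phys_act V A s)) = (\<Sum>s\<in>UNIV. A s ** M ** adj (A s))"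
proof -
  have "phys_act V A s ** M ** adj (phys_act V A s) =
    (\<Sum>t\<in>UNIV. \<Sum>u\<in>UNIV. cscale (cnj (V $ s $ t) * V $ s $ u) (A u ** M ** adj (A t)))" for s
    by (simp add: phys_act_def adj_sum matrix_mult_sum_left matrix_mult_sum_right cscale_sum_right mult.commute)
  then show ?thesis
    using unitary_sum_collapse[OF assms, of "\<lambda>t u. A u ** M ** adj (A t)"] by simp
qed

text \<open>Every column of \<open>X\<close> has squared norm \<open>c\<close>, and some column is
  nonzero.\<close>

lemma adj_self_scalar:
  fixes X :: "complex^'n^'n"
  assumes "X \<noteq> 0" "adj X ** X = cscale c (mat 1)"
  shows "\<exists>r>0. c = complex_of_real r"
proof -
  have d: "c = complex_of_real (\<Sum>k\<in>UNIV. (cmod (X $ k $ i))\<^sup>2)" for i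
  proof -
    have "c = (adj X ** X) $ i $ i" by (simp add: assms mat_def)
    also have "\<dots> = complex_of_real (\<Sum>k\<in>UNIV. (cmod (X $ k $ i))\<^sup>2)"
      unfolding matrix_matrix_mult_def by (simp add: complex_norm_square mult.commute del: of_real_power)
    finally show ?thesis .
  qed
  obtain k i where "X $ k $ i \<noteq> 0" using assms(1) by (auto simp: vec_eq_iff)
  then have "0 < (\<Sum>k\<in>UNIV. (cmod (X $ k $ i))\<^sup>2)"
    by (intro sum_pos2[of UNIV k]) auto
  then show ?thesis using d by blast
qed

section \<open>Contraction in the weighted norm and its equality case\<close>

context canonical_mps
begin

definition weight :: "complex^'b^'b \<Rightarrow> real"
  where "weight X = Re (trace (X ** \<rho> ** adj X))"

lemma weight_nonneg: "0 \<le> weight X"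
  and weight_eq_0: "weight X = 0 \<Longrightarrow> X = 0"
  unfolding weight_def
  by (fact positive_definite_sandwich(1)[OF rho_pos], erule positive_definite_sandwich(2)[OF rho_pos])

lemma weight_cscale: "weight (cscale c X) = (cmod c)\<^sup>2 * weight X"
proof -
  have "trace (cscale c X ** \<rho> ** adj (cscale c X)) = complex_of_real ((cmod c)\<^sup>2) * trace (X ** \<rho> ** adj X)"
    by (simp add: trace_cscale complex_norm_square mult_ac del: of_real_power)
  then show ?thesis by (simp add: weight_def del: of_real_power)
qed

text \<open>Expand the square, with \<open>Y\<close> for the image of \<open>X\<close>. The isometry
  property of \<open>A\<close> turns the first sum into the weight of \<open>Y\<close>; in each
  cross term the sum over \<open>s\<close> rebuilds \<open>Y\<close> or its adjoint; the assumption
  on \<open>B\<close> turns the last sum into the weight of \<open>X\<close>.\<close>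

lemma mixed_transfer_weight:
  assumes B: "(\<Sum>s\<in>UNIV. B s ** \<rho> ** adj (B s)) = \<rho>"
  shows "(\<Sum>s\<in>UNIV. weight (A s ** mixed_transfer A B X - X ** B s)) = weight X - weight (mixed_transfer A B X)"
proof -
  define Y where "Y = mixed_transfer A B X"
  let ?t = "\<lambda>P Q. trace (P ** \<rho> ** adj Q)"
  have adjY: "adj Y = (\<Sum>s\<in>UNIV. adj (B s) ** adj X ** A s)"
    by (simp add: Y_def mixed_transfer_def adj_sum adj_mult matrix_mul_assoc)
  have 1: "(\<Sum>s\<in>UNIV. ?t (A s ** Y) (A s ** Y)) = ?t Y Y"
  proof -
    have "?t (A s ** Y) (A s ** Y) = trace (Y ** \<rho> ** adj Y ** (adj (A s) ** A s))" for s
      using trace_mul_sym[of "A s" "Y ** \<rho> ** adj Y ** adj (A s)"] by (simp add: adj_mult matrix_mul_assoc)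
    then show ?thesis
      by (simp add: isometry_sum flip: trace_sum matrix_mult_sum_right)
  qed
  have 2: "(\<Sum>s\<in>UNIV. ?t (A s ** Y) (X ** B s)) = ?t Y Y"
  proof -
    have "?t (A s ** Y) (X ** B s) = trace (Y ** \<rho> ** (adj (B s) ** adj X ** A s))" for s
      using trace_mul_sym[of "A s" "Y ** \<rho> ** adj (B s) ** adj X"] by (simp add: adj_mult matrix_mul_assoc)
    then show ?thesis
      by (simp add: adjY flip: trace_sum matrix_mult_sum_right)
  qed
  have 3: "(\<Sum>s\<in>UNIV. ?t (X ** B s) (A s ** Y)) = ?t Y Y"
  proof -
    have "?t (X ** B s) (A s ** Y) = trace ((adj (A s) ** X ** B s) ** (\<rho> ** adj Y))" for s
      using trace_mul_sym[of "X ** B s ** \<rho> ** adj Y" "adj (A s)"] by (simp add: adj_mult matrix_mul_assoc)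
    then have "(\<Sum>s\<in>UNIV. ?t (X ** B s) (A s ** Y)) = trace (Y ** (\<rho> ** adj Y))"
      by (simp add: Y_def mixed_transfer_def flip: trace_sum matrix_mult_sum_left)
    then show ?thesis by (simp add: matrix_mul_assoc)
  qed
  have 4: "(\<Sum>s\<in>UNIV. ?t (X ** B s) (X ** B s)) = ?t X X"
  proof -
    have "?t (X ** B s) (X ** B s) = trace (X ** (B s ** \<rho> ** adj (B s)) ** adj X)" for s
      by (simp add: adj_mult matrix_mul_assoc)
    then show ?thesis
      by (simp add: B flip: trace_sum matrix_mult_sum_right matrix_mult_sum_left)
  qed
  have "?t (P - Q) (P - Q) = ?t P P - ?t P Q - ?t Q P + ?t Q Q" for P Q :: "complex^'b^'b"
    by (simp add: adj_diff matrix_diff_ldistrib matrix_diff_rdistrib trace_sub)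
  then have "(\<Sum>s\<in>UNIV. ?t (A s ** Y - X ** B s) (A s ** Y - X ** B s)) = ?t X X - ?t Y Y"
    by (simp add: sum.distrib sum_subtractf 1 2 3 4)
  then show ?thesis
    unfolding weight_def Y_def[symmetric] by (simp flip: Re_sum)
qed

lemma mixed_transfer_weight_le:
  assumes "(\<Sum>s\<in>UNIV. B s ** \<rho> ** adj (B s)) = \<rho>"
  shows "weight (mixed_transfer A B X) \<le> weight X"
proof -
  have "0 \<le> (\<Sum>s\<in>UNIV. weight (A s ** mixed_transfer A B X - X ** B s))"
    by (intro sum_nonneg weight_nonneg)
  then show ?thesis by (simp add: mixed_transfer_weight[OF assms])
qed

lemma mixed_transfer_weight_eq:
  assumes "(\<Sum>s\<in>UNIV. B s ** \<rho> ** adj (B s)) = \<rho>" "weight (mixed_transfer A B X) = weight X"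
  shows "A s ** mixed_transfer A B X = X ** B s"
proof -
  have "(\<Sum>s\<in>UNIV. weight (A s ** mixed_transfer A B X - X ** B s)) = 0"
    using mixed_transfer_weight[OF assms(1), of X] assms(2) by simp
  then have "weight (A s ** mixed_transfer A B X - X ** B s) = 0"
    using weight_nonneg by (subst (asm) sum_nonneg_eq_0_iff) auto
  then show ?thesis using weight_eq_0 by fastforce
qed

lemma symmetric_cell_eigenvalue:
  assumes L: "0 < length Vs"
    and sym: "\<And>k. 1 \<le> k \<Longrightarrow> eigenstate (concat (replicate k Vs)) (mps_state A)"
  shows "\<exists>\<mu> X. 1 \<le> cmod \<mu> \<and> X \<noteq> 0 \<and>
    fold (mixed_transfer A) (map (\<lambda>V. phys_act V A) Vs) X = cscale \<mu> X"
proof (rule ccontr)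
  define F where "F = fold (mixed_transfer A) (map (\<lambda>V. phys_act V A) Vs)"
  assume "\<not> ?thesis"
  then have ev: "cmod \<mu> < 1" if "is_eigenvalue F \<mu>" for \<mu>
    using that unfolding is_eigenvalue_def F_def by (meson not_less)
  have F: "clinear_op F"
    unfolding F_def by (intro clinear_op_fold clinear_mixed_transfer)
  have "(\<lambda>k. op_trace (F ^^ k)) \<longlonglongrightarrow> op_trace (\<lambda>X :: complex^'b^'b. 0)"
    by (intro tendsto_op_trace powers_tendsto_0[OF F ev])
  \<comment> \<open>The shift by one matches the eigenstate condition, which concerns positive
    numbers of cells.\<close>
  then have lim0: "(\<lambda>k. cmod (op_trace (F ^^ Suc k))) \<longlonglongrightarrow> 0"
    using LIMSEQ_Suc tendsto_norm_zero by (fastforce simp: op_trace_def)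
  have "(\<lambda>n. op_trace (transfer A ^^ n)) \<longlonglongrightarrow> 1"
    using tendsto_op_trace[of "\<lambda>n. transfer A ^^ n", OF transfer_powers_tendsto] by (simp add: op_trace_rank_one trace_rho)
  moreover have "filterlim (\<lambda>k. Suc k * length Vs) sequentially sequentially"
    using L by (intro filterlim_subseq strict_monoI) auto
  ultimately have "(\<lambda>k. op_trace (transfer A ^^ (Suc k * length Vs))) \<longlonglongrightarrow> 1"
    by (rule filterlim_compose)
  then have lim1: "(\<lambda>k. cmod (op_trace (transfer A ^^ (Suc k * length Vs)))) \<longlonglongrightarrow> cmod 1"
    by (rule tendsto_norm)
  have "cmod (op_trace (F ^^ Suc k)) = cmod (op_trace (transfer A ^^ (Suc k * length Vs)))" for k
  proof -
    let ?Vs = "concat (replicate (Suc k) Vs)"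
    obtain \<theta> :: real where \<theta>: "\<And>w. length w = length ?Vs \<Longrightarrow>
        tensor_op ?Vs (mps_state A) w = exp (\<i> * complex_of_real \<theta>) * mps_state A w"
      using sym[of "Suc k"] unfolding eigenstate_def by auto
    have len: "length ?Vs = Suc k * length Vs"
      by (simp add: length_concat sum_list_replicate del: replicate_Suc)
    have "op_trace (F ^^ Suc k) = (\<Sum>w | length w = length ?Vs. cnj (mps_state A w) * tensor_op ?Vs (mps_state A) w)"
      unfolding overlap_op_trace F_def fold_map_concat_replicate ..
    also have "\<dots> = (\<Sum>w | length w = length ?Vs. exp (\<i> * complex_of_real \<theta>) * (cnj (mps_state A w) * mps_state A w))"
      by (intro sum.cong refl) (simp add: \<theta> del: replicate_Suc)
    also have "\<dots> = exp (\<i> * complex_of_real \<theta>) * op_trace (transfer A ^^ (Suc k * length Vs))"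
      unfolding len self_overlap_op_trace[symmetric] sum_distrib_left ..
    finally show ?thesis by (simp add: norm_mult)
  qed
  then show False
    using lim0 lim1 LIMSEQ_unique by fastforce
qed

lemma push_through_exists:
  fixes V :: "int \<Rightarrow> complex^'d^'d"
  assumes L: "1 \<le> L" and V: "\<And>j. unitary (V j)"
    and sym: "\<And>k. 1 \<le> k \<Longrightarrow> eigenstate (concat (replicate k (map V [1..int L]))) (mps_state A)"
  shows "\<exists>x. (\<forall>j\<in>{0..int L}. unitary (x j)) \<and> phase_eq (x 0) (x (int L)) \<and>
    (\<forall>j\<in>{1..int L}. \<forall>s. phys_act (V j) A s = adj (x (j - 1)) ** A s ** x j)"
proof -
  define B where "B j = phys_act (V j) A" for j
  obtain \<mu> X where mu: "1 \<le> cmod \<mu>" "X \<noteq> 0"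
    and ev: "fold (mixed_transfer A) (map B [1..int L]) X = cscale \<mu> X"
  proof -
    have "map B [1..int L] = map (\<lambda>V. phys_act V A) (map V [1..int L])"
      by (simp add: B_def)
    then show thesis
      using symmetric_cell_eigenvalue[of "map V [1..int L]", OF _ sym] L that by (metis length_map length_upto
        of_nat_0_less_iff add_diff_cancel nat_int less_le_trans zero_less_one diff_add_cancel)
  qed
  \<comment> \<open>The eigenvector transported through the first \<open>n\<close> sites of the
    cell; after normalisation it becomes the bond unitary at bond \<open>n\<close>.\<close>
  define Z where "Z n = fold (mixed_transfer A) (map B [1..int n]) X" for n
  have Z0: "Z 0 = X" by (simp add: Z_def)
  have ZL: "Z L = cscale \<mu> X" using ev by (simp add: Z_def)
  have Z_Suc: "Z (Suc n) = mixed_transfer A (B (int (Suc n))) (Z n)" for n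
  proof -
    have "[1..int (Suc n)] = [1..int n] @ [int (Suc n)]"
      using upto_rec2[of 1 "int (Suc n)"] by simp
    then show ?thesis by (simp add: Z_def)
  qed
  have B: "(\<Sum>s\<in>UNIV. B j s ** \<rho> ** adj (B j s)) = \<rho>" for j
    unfolding B_def phys_act_dual_transfer[OF V] by (rule rho_fixed)
  have anti: "weight (Z n) \<le> weight (Z m)" if "m \<le> n" for m n
    using that by (rule lift_Suc_antimono_le[rotated]) (simp add: Z_Suc mixed_transfer_weight_le[OF B])
  have wX: "0 < weight X" using mu weight_nonneg weight_eq_0 by (metis order_le_less)
  have wL: "weight (Z L) = (cmod \<mu>)\<^sup>2 * weight X" by (simp add: ZL weight_cscale)
  moreover have "1 \<le> (cmod \<mu>)\<^sup>2" using mu by simp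
  \<comment> \<open>The weights decrease along the cell, yet the last one is at least the first
    because \<open>1 \<le> cmod \<mu>\<close>; so all are equal.\<close>
  ultimately have "weight (Z 0) \<le> weight (Z L)"
    using wX by (simp add: Z0)
  then have eq: "weight (Z n) = weight X" if "n \<le> L" for n
    using anti[of 0 n] anti[of n L] that by (simp add: Z0)
  have mu1: "cmod \<mu> = 1"
    using eq[of L] wL wX mu by (simp add: power2_eq_1_iff)
  have push: "A s ** Z (Suc n) = Z n ** B (int (Suc n)) s" if "n < L" for n s
    unfolding Z_Suc using that eq[of n] eq[of "Suc n"]
    by (intro mixed_transfer_weight_eq[OF B]) (simp add: Z_Suc)
  have gram_Suc: "adj (Z (Suc n)) ** Z (Suc n) = transfer A (adj (Z n) ** Z n)" if "n < L" for n
  proof -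
    have "adj (Z (Suc n)) ** Z (Suc n) = adj (Z (Suc n)) ** (\<Sum>s\<in>UNIV. adj (A s) ** A s) ** Z (Suc n)"
      by (simp add: isometry_sum)
    also have "\<dots> = (\<Sum>s\<in>UNIV. adj (A s ** Z (Suc n)) ** (A s ** Z (Suc n)))"
      by (simp add: matrix_mult_sum_left matrix_mult_sum_right adj_mult matrix_mul_assoc)
    also have "\<dots> = transfer (B (int (Suc n))) (adj (Z n) ** Z n)"
      by (simp only: push[OF that] transfer_def adj_mult matrix_mul_assoc)
    finally show ?thesis by (simp add: B_def phys_act_transfer[OF V])
  qed
  have gram: "adj (Z n) ** Z n = (transfer A ^^ n) (adj X ** X)" if "n \<le> L" for n
    using that by (induction n) (simp_all add: Z0 gram_Suc)
  \<comment> \<open>Over a full cell \<open>\<mu>\<close> meets its conjugate and cancels, leaving a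
    true fixed point.\<close>
  have "(transfer A ^^ L) (adj X ** X) = adj X ** X"
    using gram[of L] cnj_mult_self_unit[OF mu1] by (simp add: ZL mult.commute)
  then obtain c where c: "adj X ** X = cscale c (mat 1)"
    using transfer_funpow_fixed[of L] L by (metis less_le_trans zero_less_one)
  obtain r where r: "0 < r" "c = complex_of_real r" using adj_self_scalar[OF mu(2) c] by blast
  have gram1: "adj (Z n) ** Z n = cscale r (mat 1)" if "n \<le> L" for n
    by (simp add: gram[OF that] c r clinear_op_cscale[OF clinear_op_funpow[OF clinear_transfer]] transfer_funpow_1)
  \<comment> \<open>This real factor normalises the Gram matrices, which are \<open>r\<close> times
    the identity, to the identity.\<close>
  define a where "a = complex_of_real (1 / sqrt r)"
  have a: "a * a * complex_of_real r = 1" "cnj a = a"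
    using r by (simp_all add: a_def field_simps flip: of_real_mult)
  define x where "x j = cscale a (Z (nat j))" for j
  show ?thesis
  proof (intro exI[of _ x] conjI ballI allI)
    fix j assume "j \<in> {0..int L}"
    then have "adj (x j) ** x j = mat 1"
      using a by (simp add: x_def gram1 nat_le_iff mult_ac)
    then show "unitary (x j)"
      by (simp add: unitary_def matrix_left_right_inverse)
  next
    have "x (int L) = cscale \<mu> (x 0)"
      by (simp add: x_def Z0 ZL mult.commute)
    then have "phase_eq (x (int L)) (x 0)"
      unfolding phase_eq_def using mu1 by blast
    then show "phase_eq (x 0) (x (int L))"
      by (rule phase_eq_sym)
  next
    fix j s assume j: "j \<in> {1..int L}"
    define n where "n = nat (j - 1)"
    have n: "nat j = Suc n" "nat (j - 1) = n" "n < L" "int (Suc n) = j" using j by (auto simp: n_def)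
    have "adj (Z n) ** (A s ** Z (Suc n)) = cscale r (B j s)"
      unfolding push[OF n(3)] n(4) using gram1[of n] n(3) by (simp add: matrix_mul_assoc)
    then have "adj (Z n) ** A s ** Z (Suc n) = cscale r (B j s)"
      by (simp add: matrix_mul_assoc)
    then show "phys_act (V j) A s = adj (x (j - 1)) ** A s ** x j"
      using a by (simp add: x_def n B_def mult_ac)
  qed
qed

end

text \<open>The unitary \<open>W j = x j ** adj (y j)\<close> measures the discrepancy of the two
  families. It intertwines \<open>A\<close> with itself cyclically, hence is a scalar, and a unitary
  scalar is a phase.\<close>

lemma push_through_unique:
  fixes A :: "('d::finite, 'b::finite) mps" and x y :: "int \<Rightarrow> complex^'b^'b"
  assumes A: "left_canonical_injective A" and L: "1 \<le> L"
    and x: "\<And>j. j \<in> {0..int L} \<Longrightarrow> unitary (x j)" "phase_eq (x 0) (x (int L))"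
    and y: "\<And>j. j \<in> {0..int L} \<Longrightarrow> unitary (y j)" "phase_eq (y 0) (y (int L))"
    and xy: "\<And>j. j \<in> {1..int L} \<Longrightarrow>
      mps_phase_eq (\<lambda>s. adj (x (j - 1)) ** A s ** x j) (\<lambda>s. adj (y (j - 1)) ** A s ** y j)"
    and j: "j \<in> {0..int L}"
  shows "phase_eq (x j) (y j)"
proof -
  obtain \<rho> where "canonical_mps A \<rho>" using A left_canonical_injective_canonical_mps by blast
  then interpret canonical_mps A \<rho> .
  have ux: "adj (x j) ** x j = mat 1" "x j ** adj (x j) = mat 1" if "j \<in> {0..int L}" for j
    using x(1)[OF that] by (auto simp: unitary_def)
  have uy: "adj (y j) ** y j = mat 1" "y j ** adj (y j) = mat 1" if "j \<in> {0..int L}" for j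
    using y(1)[OF that] by (auto simp: unitary_def)
  define W where "W j = x j ** adj (y j)" for j
  have W: "unitary (W j)" if "j \<in> {0..int L}" for j
    unfolding W_def using that x(1) y(1) by (intro unitary_mult unitary_adj)
  obtain c where c: "\<And>j. j \<in> {1..int L} \<Longrightarrow> cmod (c j) = 1"
    "\<And>j s. j \<in> {1..int L} \<Longrightarrow> adj (x (j - 1)) ** A s ** x j = cscale (c j) (adj (y (j - 1)) ** A s ** y j)"
    using xy unfolding mps_phase_eq_def by metis
  have int: "W (j - 1) ** A s = cscale (inverse (c j)) (A s ** W j)" if j: "j \<in> {1..int L}" for j s
  proof -
    have j': "j - 1 \<in> {0..int L}" "j \<in> {0..int L}" using j by auto
    have "A s ** W j = x (j - 1) ** (adj (x (j - 1)) ** A s ** x j) ** adj (y j)"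
      by (simp add: W_def matrix_mul_assoc ux[OF j'(1)])
    also have "\<dots> = cscale (c j) (W (j - 1) ** A s ** (y j ** adj (y j)))"
      unfolding c(2)[OF j] by (simp add: W_def matrix_mul_assoc)
    finally have "A s ** W j = cscale (c j) (W (j - 1) ** A s)"
      by (simp add: uy[OF j'(2)])
    moreover have "c j \<noteq> 0" using c(1)[OF j] by auto
    ultimately show ?thesis by simp
  qed
  obtain a b where ab: "cmod a = 1" "x 0 = cscale a (x (int L))" "cmod b = 1" "y 0 = cscale b (y (int L))"
    using x(2) y(2) unfolding phase_eq_def by auto
  \<comment> \<open>The phase \<open>b\<close> appears conjugated because \<open>y\<close> enters
    \<open>W\<close> through its adjoint.\<close>
  have "W 0 = cscale (cnj b * a) (W (int L))"
    by (simp add: W_def ab)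
  moreover have "cmod (cnj b * a) = 1" using ab by (simp add: norm_mult)
  moreover have "W 0 \<noteq> 0" using W[of 0] by (simp add: unitary_neq_0)
  moreover have "cmod (inverse (c j)) = 1" if "j \<in> {1..int L}" for j
    using c(1)[OF that] by (simp add: norm_inverse)
  ultimately obtain t where t: "W j = cscale t (mat 1)"
    using cyclic_intertwiner_scalar[where W = W and c = "\<lambda>j. inverse (c j)" and j = j and L = L] L int j
    by metis
  have "x j = W j ** y j"
    by (simp add: W_def uy[OF j] flip: matrix_mul_assoc)
  then have "x j = cscale t (y j)" by (simp add: t)
  moreover have "cmod t = 1" using W[OF j] unitary_scalar by (simp add: t)
  ultimately show ?thesis unfolding phase_eq_def by blast
qed

text \<open>The group elements are treated separately and the results collected by choice; how
  different elements multiply is a matter of uniqueness, not of this construction.\<close>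

lemma symmetric_mps_bond_unitaries:
  fixes U :: "'g \<Rightarrow> int \<Rightarrow> complex^'d::finite^'d" and A :: "('d, 'b::finite) mps"
  assumes A: "left_canonical_injective A" and L: "1 \<le> L"
    and U: "\<And>g j. g \<in> carrier G \<Longrightarrow> unitary (U g j)"
    and sym: "symmetric_mps G L U A"
  shows "\<exists>v. bond_unitaries G L U A v"
proof -
  obtain \<rho> where rho: "canonical_mps A \<rho>" using A left_canonical_injective_canonical_mps by blast
  have "\<exists>x. (\<forall>j\<in>{0..int L}. unitary (x j)) \<and> phase_eq (x 0) (x (int L)) \<and>
      (\<forall>j\<in>{1..int L}. \<forall>s. phys_act (U g j) A s = adj (x (j - 1)) ** A s ** x j)" if g: "g \<in> carrier G" for g
    using canonical_mps.push_through_exists[OF rho L, of "U g"] U[OF g] sym g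
    unfolding symmetric_mps_def cell_factors_def by blast
  then obtain x where x: "\<And>g. g \<in> carrier G \<Longrightarrow>
      (\<forall>j\<in>{0..int L}. unitary (x g j)) \<and> phase_eq (x g 0) (x g (int L)) \<and>
      (\<forall>j\<in>{1..int L}. \<forall>s. phys_act (U g j) A s = adj (x g (j - 1)) ** A s ** x g j)"
    by metis
  have "bond_unitaries G L U A (\<lambda>j g. x g j)"
    unfolding bond_unitaries_def mps_phase_eq_def using x by (auto intro!: exI[of _ "1 :: complex"])
  then show ?thesis by blast
qed


subsection \<open>Projective representations and cocycles\<close>

text \<open>The cocycle identity is associativity of \<open>v g ** v h ** v k\<close>, with the
  nonzero matrix \<open>v (g \<otimes> h \<otimes> k)\<close> cancelled.\<close>

lemma (in group) projective_cocycle: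
  fixes v :: "'a \<Rightarrow> complex^'n^'n"
  assumes v: "\<And>g. g \<in> carrier G \<Longrightarrow> v g \<noteq> 0"
    and w: "\<And>g h. g \<in> carrier G \<Longrightarrow> h \<in> carrier G \<Longrightarrow>
      cmod (\<omega> (g, h)) = 1 \<and> v g ** v h = cscale (\<omega> (g, h)) (v (g \<otimes> h))"
  shows "two_cocycle G \<omega>"
  unfolding two_cocycle_def
proof (intro conjI ballI)
  fix g h k assume c: "g \<in> carrier G" "h \<in> carrier G" "k \<in> carrier G"
  have "(v g ** v h) ** v k = cscale (\<omega> (g, h) * \<omega> (g \<otimes> h, k)) (v (g \<otimes> h \<otimes> k))"
    using w c by simp
  moreover have "v g ** (v h ** v k) = cscale (\<omega> (h, k) * \<omega> (g, h \<otimes> k)) (v (g \<otimes> h \<otimes> k))"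
    using w c by (simp add: m_assoc)
  ultimately show "\<omega> (g, h) * \<omega> (g \<otimes> h, k) = \<omega> (h, k) * \<omega> (g, h \<otimes> k)"
    using v[of "g \<otimes> h \<otimes> k"] c by (simp add: matrix_mul_assoc cscale_cancel)
qed (use w in auto)

lemma phys_act_mult: "phys_act (V ** W) A = phys_act V (phys_act W A)"
proof
  fix s
  have "phys_act (V ** W) A s = (\<Sum>u\<in>UNIV. \<Sum>t\<in>UNIV. cscale (V $ s $ t * W $ t $ u) (A u))"
    by (simp add: phys_act_def matrix_matrix_mult_def cscale_sum_left)
  also have "\<dots> = phys_act V (phys_act W A) s"
    by (subst sum.swap) (simp add: phys_act_def cscale_sum_right)
  finally show "phys_act (V ** W) A s = phys_act V (phys_act W A) s" .
qed

lemma phys_act_cscale: "phys_act (cscale c V) A s = cscale c (phys_act V A s)"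
  by (simp add: phys_act_def cscale_sum_right)

lemma phys_act_bond:
  "phys_act V (\<lambda>s. cscale c (P ** A s ** Q)) s = cscale c (P ** phys_act V A s ** Q)"
  by (simp add: phys_act_def matrix_mult_sum_left matrix_mult_sum_right cscale_sum_right mult.commute)

lemma mps_phase_eq_sym: "mps_phase_eq A B \<Longrightarrow> mps_phase_eq B A"
proof -
  assume "mps_phase_eq A B"
  then obtain c where c: "cmod c = 1" "\<And>s. A s = cscale c (B s)" unfolding mps_phase_eq_def by blast
  then have "c \<noteq> 0" by auto
  then show ?thesis
    unfolding mps_phase_eq_def using c by (intro exI[of _ "inverse c"]) (simp add: norm_inverse)
qed

lemma mps_phase_eq_trans: "mps_phase_eq A B \<Longrightarrow> mps_phase_eq B C \<Longrightarrow> mps_phase_eq A C"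
  unfolding mps_phase_eq_def by (metis cscale_cscale norm_mult mult_1)

lemma phase_eq_mult: "phase_eq X Y \<Longrightarrow> phase_eq X' Y' \<Longrightarrow> phase_eq (X ** X') (Y ** Y')"
  unfolding phase_eq_def by (metis cscale_cscale cscale_mult_left cscale_mult_right norm_mult mult_1)

lemma mps_phase_eq_bond:
  assumes "phase_eq P P'" "phase_eq Q Q'"
  shows "mps_phase_eq (\<lambda>s. adj P ** A s ** Q) (\<lambda>s. adj P' ** A s ** Q')"
proof -
  obtain a b where ab: "cmod a = 1" "P = cscale a P'" "cmod b = 1" "Q = cscale b Q'"
    using assms unfolding phase_eq_def by auto
  then show ?thesis
    unfolding mps_phase_eq_def
    by (intro exI[of _ "cnj a * b"]) (simp add: norm_mult mult.commute)
qed

lemma (in group) bond_unitaries_cohomology: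
  fixes A :: "('d::finite, 'n::finite) mps" and U :: "'a \<Rightarrow> int \<Rightarrow> complex^'d^'d"
  assumes L: "1 \<le> L"
    and T: "T \<in> hom G G"
    and Uper: "\<And>g j. g \<in> carrier G \<Longrightarrow> U g (j + int L) = U g j"
    and UT: "\<And>g j. g \<in> carrier G \<Longrightarrow> U g j = U (T g) (j - 1)"
    and \<nu>: "\<And>j. two_cocycle G (\<nu> j)"
    and U\<nu>: "\<And>g h j. g \<in> carrier G \<Longrightarrow> h \<in> carrier G \<Longrightarrow>
      U g j ** U h j = cscale (\<nu> j (g, h)) (U (g \<otimes> h) j)"
    and A: "left_canonical_injective A"
    and v: "bond_unitaries G L U A v"
  shows "\<exists>\<omega>. (\<forall>j\<in>{0..int L}. two_cocycle G (\<omega> j) \<and>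
            (\<forall>g\<in>carrier G. \<forall>h\<in>carrier G.
              v j g ** v j h = cscale (\<omega> j (g, h)) (v j (g \<otimes> h)))) \<and>
          (\<forall>j\<in>{1..int L}.
            H2_class G (\<omega> j) = H2_class G (\<nu> j) \<otimes>\<^bsub>H2 G\<^esub> H2_class G (\<omega> (j - 1)) \<and>
            H2_class G (\<omega> j) = H2_class G (pullback2 T (\<omega> (j - 1))))"
proof -
  have Tc: "T g \<in> carrier G" if "g \<in> carrier G" for g
    using T that by (rule hom_in_carrier)
  have vu: "unitary (v j g)" if "g \<in> carrier G" "j \<in> {0..int L}" for g j
    using v that unfolding bond_unitaries_def by blast
  have vcyc: "phase_eq (v 0 g) (v (int L) g)" if "g \<in> carrier G" for g
    using v that unfolding bond_unitaries_def by blast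
  have vpush: "mps_phase_eq (phys_act (U g j) A) (\<lambda>s. adj (v (j - 1) g) ** A s ** v j g)"
    if "g \<in> carrier G" "j \<in> {1..int L}" for g j
    using v that unfolding bond_unitaries_def by blast
  have "\<forall>p\<in>carrier G \<times> {1..int L}. \<exists>c. cmod c = 1 \<and> (\<forall>s. phys_act (U (fst p) (snd p)) A s =
      cscale c (adj (v (snd p - 1) (fst p)) ** A s ** v (snd p) (fst p)))"
    using vpush unfolding mps_phase_eq_def by auto
  from bchoice[OF this] obtain a' where a': "\<forall>p\<in>carrier G \<times> {1..int L}. cmod (a' p) = 1 \<and>
      (\<forall>s. phys_act (U (fst p) (snd p)) A s =
        cscale (a' p) (adj (v (snd p - 1) (fst p)) ** A s ** v (snd p) (fst p)))"
    by blast
  define a where "a j g = a' (g, j)" for j g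
  have a: "cmod (a j g) = 1"
    "phys_act (U g j) A = (\<lambda>s. cscale (a j g) (adj (v (j - 1) g) ** A s ** v j g))"
    if "g \<in> carrier G" "j \<in> {1..int L}" for g j
    using a' that by (auto simp: a_def)

  \<comment> \<open>The action of \<open>U g j ** U h j\<close> is computed twice: by pushing
    through two times, and by the projective multiplication law.\<close>
  have prod: "cscale (a j g * a j h) (adj (v (j - 1) g ** v (j - 1) h) ** A s ** (v j g ** v j h)) =
      cscale (\<nu> j (g, h) * a j (g \<otimes> h)) (adj (v (j - 1) (g \<otimes> h)) ** A s ** v j (g \<otimes> h))"
    if g: "g \<in> carrier G" and h: "h \<in> carrier G" and j: "j \<in> {1..int L}" for g h j s
  proof -
    have "phys_act (U g j ** U h j) A s =
        cscale (a j g * a j h) (adj (v (j - 1) g ** v (j - 1) h) ** A s ** (v j g ** v j h))"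
      by (simp add: phys_act_mult a(2)[OF h j] phys_act_bond a(2)[OF g j] adj_mult matrix_mul_assoc mult.commute)
    moreover have "phys_act (U g j ** U h j) A s =
        cscale (\<nu> j (g, h) * a j (g \<otimes> h)) (adj (v (j - 1) (g \<otimes> h)) ** A s ** v j (g \<otimes> h))"
      using g h j by (simp add: U\<nu> phys_act_cscale a(2))
    ultimately show ?thesis by simp
  qed

  have proj: "phase_eq (v j g ** v j h) (v j (g \<otimes> h))"
    if g: "g \<in> carrier G" and h: "h \<in> carrier G" and j: "j \<in> {0..int L}" for g h j
  proof (rule push_through_unique[OF A L _ _ _ _ _ j, where x = "\<lambda>j. v j g ** v j h" and y = "\<lambda>j. v j (g \<otimes> h)"])
    fix j assume j: "j \<in> {1..int L}"
    let ?c = "\<nu> j (g, h) * a j (g \<otimes> h) / (a j g * a j h)"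
    have nz: "a j g * a j h \<noteq> 0" using a(1)[OF g j] a(1)[OF h j] by auto
    have "adj (v (j - 1) g ** v (j - 1) h) ** A s ** (v j g ** v j h) =
      cscale ?c (adj (v (j - 1) (g \<otimes> h)) ** A s ** v j (g \<otimes> h))" for s
    proof -
      have "cscale (inverse (a j g * a j h)) (cscale (a j g * a j h)
          (adj (v (j - 1) g ** v (j - 1) h) ** A s ** (v j g ** v j h))) =
        cscale ?c (adj (v (j - 1) (g \<otimes> h)) ** A s ** v j (g \<otimes> h))"
        unfolding prod[OF g h j] by (simp add: divide_inverse mult_ac)
      then show ?thesis using nz by (simp del: inverse_mult_distrib)
    qed
    moreover have "cmod ?c = 1"
      using a(1) g h j \<nu>[of j] by (simp add: norm_divide norm_mult two_cocycle_def)
    ultimately show "mps_phase_eq (\<lambda>s. adj (v (j - 1) g ** v (j - 1) h) ** A s ** (v j g ** v j h))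
        (\<lambda>s. adj (v (j - 1) (g \<otimes> h)) ** A s ** v j (g \<otimes> h))"
      unfolding mps_phase_eq_def by blast
  qed (use g h vu vcyc in \<open>auto intro!: unitary_mult phase_eq_mult\<close>)

  define \<omega> where "\<omega> j p = (SOME c. cmod c = 1 \<and>
      v j (fst p) ** v j (snd p) = cscale c (v j (fst p \<otimes> snd p)))" for j p
  have \<omega>: "cmod (\<omega> j (g, h)) = 1 \<and> v j g ** v j h = cscale (\<omega> j (g, h)) (v j (g \<otimes> h))"
    if "g \<in> carrier G" "h \<in> carrier G" "j \<in> {0..int L}" for g h j
    using someI_ex[OF proj[OF that, unfolded phase_eq_def]] by (simp add: \<omega>_def)
  have coc: "two_cocycle G (\<omega> j)" if "j \<in> {0..int L}" for j
    using that vu unitary_neq_0 by (intro projective_cocycle[of "v j"] \<omega>) blast+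

  have shift: "H2_class G (\<omega> j) = H2_class G (\<nu> j) \<otimes>\<^bsub>H2 G\<^esub> H2_class G (\<omega> (j - 1))"
    if j: "j \<in> {1..int L}" for j
  proof -
    have j': "j - 1 \<in> {0..int L}" "j \<in> {0..int L}" using j by auto
    have "two_coboundary G (\<lambda>p. \<omega> j p / (\<nu> j p * \<omega> (j - 1) p))"
      unfolding two_coboundary_def
    \<comment> \<open>The phases of the push-through relation supply the cochain. Inserting both
      projective laws into \<open>prod\<close> gives \<open>a j g * a j h * \<omega> j = \<nu> j * a
      j (g \<otimes> h) * \<omega> (j - 1)\<close> at \<open>(g, h)\<close>, so the quotient is the
      coboundary of the inverse of \<open>a j\<close>.\<close>
    proof (intro exI[of _ "\<lambda>g. inverse (a j g)"] conjI ballI)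
      fix g h assume g: "g \<in> carrier G" and h: "h \<in> carrier G"
      have gh: "g \<otimes> h \<in> carrier G" using g h by simp
      obtain \<rho> where "canonical_mps A \<rho>" using A left_canonical_injective_canonical_mps by blast
      then obtain s where s: "A s \<noteq> 0" using canonical_mps.A_nonzero by blast
      \<comment> \<open>A nonzero matrix common to both sides, so that the scalar coefficients can
        be compared.\<close>
      let ?B = "adj (v (j - 1) (g \<otimes> h)) ** A s ** v j (g \<otimes> h)"
      have "v (j - 1) (g \<otimes> h) ** ?B ** adj (v j (g \<otimes> h)) =
          (v (j - 1) (g \<otimes> h) ** adj (v (j - 1) (g \<otimes> h))) ** A s ** (v j (g \<otimes> h) ** adj (v j (g \<otimes> h)))"
        by (simp add: matrix_mul_assoc)
      also have "\<dots> = A s" using vu[OF gh j'(1)] vu[OF gh j'(2)] by (simp add: unitary_def)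
      finally have B: "?B \<noteq> 0" using s by auto
      have "cscale (a j g * a j h * (cnj (\<omega> (j - 1) (g, h)) * \<omega> j (g, h))) ?B =
          cscale (\<nu> j (g, h) * a j (g \<otimes> h)) ?B"
        using prod[OF g h j, of s] \<omega>[OF g h j'(1)] \<omega>[OF g h j'(2)] by (simp add: mult_ac)
      then have "a j g * a j h * (cnj (\<omega> (j - 1) (g, h)) * \<omega> j (g, h)) = \<nu> j (g, h) * a j (g \<otimes> h)"
        by (simp add: cscale_cancel[OF B])
      then have "a j g * a j h * (\<omega> j (g, h) * (\<omega> (j - 1) (g, h) * cnj (\<omega> (j - 1) (g, h)))) =
          \<nu> j (g, h) * a j (g \<otimes> h) * \<omega> (j - 1) (g, h)"
        by (simp add: mult_ac)
      then have eq: "a j g * a j h * \<omega> j (g, h) = \<nu> j (g, h) * a j (g \<otimes> h) * \<omega> (j - 1) (g, h)"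
        using cnj_mult_self_unit[of "\<omega> (j - 1) (g, h)"] \<omega>[OF g h j'(1)] by simp
      have "cmod (\<nu> j (g, h)) = 1" using \<nu>[of j] g h by (simp add: two_cocycle_def)
      then have nz: "\<nu> j (g, h) \<noteq> 0" "\<omega> (j - 1) (g, h) \<noteq> 0" "a j g \<noteq> 0" "a j h \<noteq> 0" "a j (g \<otimes> h) \<noteq> 0"
        using \<omega>[OF g h j'(1)] a(1)[OF g j] a(1)[OF h j] a(1)[OF gh j] by auto
      show "\<omega> j (g, h) / (\<nu> j (g, h) * \<omega> (j - 1) (g, h)) =
          inverse (a j g) * inverse (a j h) / inverse (a j (g \<otimes> h))"
        using nz eq by (simp add: field_simps)
    qed (use a(1)[OF _ j] in \<open>simp add: norm_inverse\<close>)
    then show ?thesis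
      using H2_class_mult[OF \<nu> coc[OF j'(1)]] H2_class_eq_iff[OF coc[OF j'(2)] two_cocycle_mult[OF \<nu> coc[OF j'(1)]]]
      by simp
  qed

  have trans: "phase_eq (v j g) (v (j - 1) (T g))" if g: "g \<in> carrier G" and j: "j \<in> {1..int L}" for g j
  proof -
    \<comment> \<open>the bond \<open>0\<close> is identified with the bond \<open>L\<close>, so the translated family starts at \<open>v (L - 1)\<close>\<close>
    define y where "y j = (if j = 0 then v (int L - 1) (T g) else v (j - 1) (T g))" for j
    note Tg = Tc[OF g]
    have "phase_eq (v j g) (y j)"
    proof (rule push_through_unique[OF A L, where x = "\<lambda>j. v j g"])
      fix i assume i: "i \<in> {1..int L}"
      have *: "mps_phase_eq (phys_act (U g i) A) (\<lambda>s. adj (y (i - 1)) ** A s ** y i)"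
      \<comment> \<open>At \<open>i = 1\<close> the translation wraps around: by periodicity site
        \<open>0\<close> is site \<open>L\<close>, and \<open>v (int L)\<close> may be replaced by
        \<open>v 0\<close> at the cost of a phase.\<close>
      proof (cases "i = 1")
        case True
        have "U g i = U (T g) (int L)"
          using UT[OF g, of 1] Uper[OF Tg, of 0] True by simp
        moreover have "mps_phase_eq (phys_act (U (T g) (int L)) A)
            (\<lambda>s. adj (v (int L - 1) (T g)) ** A s ** v (int L) (T g))"
          using vpush[OF Tg, of "int L"] L by simp
        moreover have "mps_phase_eq (\<lambda>s. adj (v (int L - 1) (T g)) ** A s ** v (int L) (T g))
            (\<lambda>s. adj (v (int L - 1) (T g)) ** A s ** v 0 (T g))"
          by (intro mps_phase_eq_bond phase_eq_sym[OF vcyc[OF Tg]]) (auto simp: phase_eq_def intro: exI[of _ 1])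
        ultimately show ?thesis
          using True by (auto simp: y_def intro: mps_phase_eq_trans)
      next
        case False
        then have "mps_phase_eq (phys_act (U (T g) (i - 1)) A)
            (\<lambda>s. adj (v (i - 1 - 1) (T g)) ** A s ** v (i - 1) (T g))"
          using i by (intro vpush Tg) auto
        then show ?thesis using UT[OF g, of i] i False by (simp add: y_def)
      qed
      show "mps_phase_eq (\<lambda>s. adj (v (i - 1) g) ** A s ** v i g) (\<lambda>s. adj (y (i - 1)) ** A s ** y i)"
        using mps_phase_eq_sym[OF vpush[OF g i]] * by (rule mps_phase_eq_trans)
    next
      show "phase_eq (y 0) (y (int L))"
        using L by (auto simp: y_def phase_eq_def intro: exI[of _ 1])
    qed (use L j vu[OF g] vu[OF Tg] vcyc[OF g] in \<open>auto simp: y_def\<close>)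
    then show ?thesis using j by (simp add: y_def)
  qed

  have pull: "H2_class G (\<omega> j) = H2_class G (pullback2 T (\<omega> (j - 1)))"
    if j: "j \<in> {1..int L}" for j
  proof -
    have j': "j - 1 \<in> {0..int L}" "j \<in> {0..int L}" using j by auto
    have "\<forall>g\<in>carrier G. \<exists>b. cmod b = 1 \<and> v j g = cscale b (v (j - 1) (T g))"
      using trans j unfolding phase_eq_def by blast
    then obtain b where b: "\<forall>g\<in>carrier G. cmod (b g) = 1 \<and> v j g = cscale (b g) (v (j - 1) (T g))"
      by (auto dest!: bchoice)
    have "two_coboundary G (\<lambda>p. \<omega> j p / pullback2 T (\<omega> (j - 1)) p)"
      unfolding two_coboundary_def
    \<comment> \<open>The phase \<open>b\<close> compares the projective representations
      \<open>v j\<close> and \<open>v (j - 1) \<circ> T\<close>, so its coboundary is the quotient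
      of their cocycles.\<close>
    proof (intro exI[of _ b] conjI ballI)
      fix g h assume g: "g \<in> carrier G" and h: "h \<in> carrier G"
      have gh: "g \<otimes> h \<in> carrier G" using g h by simp
      let ?w = "\<omega> (j - 1) (T g, T h)"
      have "v j g ** v j h = cscale (\<omega> j (g, h) * b (g \<otimes> h)) (v (j - 1) (T (g \<otimes> h)))"
        using \<omega>[OF g h j'(2)] b gh by simp
      moreover have "v j g ** v j h = cscale (b g * b h * ?w) (v (j - 1) (T (g \<otimes> h)))"
        using \<omega>[OF Tc[OF g] Tc[OF h] j'(1)] b g h by (simp add: hom_mult[OF T] mult_ac)
      ultimately have "\<omega> j (g, h) * b (g \<otimes> h) = b g * b h * ?w"
        using unitary_neq_0[OF vu[OF Tc[OF gh] j'(1)]] by (simp add: cscale_cancel)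
      moreover have "?w \<noteq> 0" "b (g \<otimes> h) \<noteq> 0"
        using \<omega>[OF Tc[OF g] Tc[OF h] j'(1)] b gh by force+
      ultimately show "\<omega> j (g, h) / pullback2 T (\<omega> (j - 1)) (g, h) = b g * b h / b (g \<otimes> h)"
        by (simp add: pullback2_def field_simps)
    qed (use b in blast)
    then show ?thesis
      using H2_class_eq_iff[OF coc[OF j'(2)] two_cocycle_pullback[OF T coc[OF j'(1)]]] by blast
  qed

  show ?thesis
    using coc \<omega> shift pull by (intro exI[of _ \<omega>]) blast
qed

theorem mainTheorem3:
  fixes G :: "('g, 'm) monoid_scheme" (structure)
    and L :: nat
    and T :: "'g \<Rightarrow> 'g"
    and U :: "'g \<Rightarrow> int \<Rightarrow> complex^'d::finite^'d"
    and \<nu> :: "int \<Rightarrow> 'g \<times> 'g \<Rightarrow> complex"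
  assumes "group G"
    and "1 \<le> L"
    and "T \<in> iso G G"
    and "\<And>g. g \<in> carrier G \<Longrightarrow> (T ^^ L) g = g"
    \<comment> \<open>families indexed by \<open>\<int>/L\<int>\<close> are \<open>L\<close>-periodic families indexed by \<open>\<int>\<close>\<close>
    and "\<And>g j. g \<in> carrier G \<Longrightarrow> U g (j + int L) = U g j"
    and "\<And>j g h. g \<in> carrier G \<Longrightarrow> h \<in> carrier G \<Longrightarrow> \<nu> (j + int L) (g, h) = \<nu> j (g, h)"
    and "\<And>g j. g \<in> carrier G \<Longrightarrow> unitary (U g j)"
    and "\<And>g j. g \<in> carrier G \<Longrightarrow> U g j = U (T g) (j - 1)"
    and "\<And>j. two_cocycle G (\<nu> j)"
    and "\<And>g h j. g \<in> carrier G \<Longrightarrow> h \<in> carrier G \<Longrightarrow>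
      U g j ** U h j = cscale (\<nu> j (g, h)) (U (g \<otimes> h) j)"
  shows "(\<forall>(A :: ('d, 'b::finite) mps) v.
      left_canonical_injective A \<and> symmetric_mps G L U A \<and> bond_unitaries G L U A v \<longrightarrow>
      (\<exists>\<omega>. (\<forall>j\<in>{0..int L}. two_cocycle G (\<omega> j) \<and>
            (\<forall>g\<in>carrier G. \<forall>h\<in>carrier G.
              v j g ** v j h = cscale (\<omega> j (g, h)) (v j (g \<otimes> h)))) \<and>
          (\<forall>j\<in>{1..int L}.
            H2_class G (\<omega> j) = H2_class G (\<nu> j) \<otimes>\<^bsub>H2 G\<^esub> H2_class G (\<omega> (j - 1)) \<and>
            H2_class G (\<omega> j) = H2_class G (pullback2 T (\<omega> (j - 1))))))
    \<and>
    ((\<nexists>c. (\<forall>j\<in>{0..int L}. c j \<in> carrier (H2 G)) \<and>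
          (\<forall>j\<in>{1..int L}.
            c j = H2_class G (\<nu> j) \<otimes>\<^bsub>H2 G\<^esub> c (j - 1) \<and>
            c j = H2_pullback G T (c (j - 1)))) \<longrightarrow>
      (\<nexists>A :: ('d, 'b) mps. left_canonical_injective A \<and> symmetric_mps G L U A))"
proof -
  interpret group G by fact
  have T: "T \<in> hom G G"
    using \<open>T \<in> iso G G\<close> by (simp add: iso_def)
  have cohomology: "\<exists>\<omega>. (\<forall>j\<in>{0..int L}. two_cocycle G (\<omega> j) \<and>
            (\<forall>g\<in>carrier G. \<forall>h\<in>carrier G.
              v j g ** v j h = cscale (\<omega> j (g, h)) (v j (g \<otimes> h)))) \<and>
          (\<forall>j\<in>{1..int L}.
            H2_class G (\<omega> j) = H2_class G (\<nu> j) \<otimes>\<^bsub>H2 G\<^esub> H2_class G (\<omega> (j - 1)) \<and>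
            H2_class G (\<omega> j) = H2_class G (pullback2 T (\<omega> (j - 1))))"
    if "left_canonical_injective A" "bond_unitaries G L U A v" for A :: "('d, 'b) mps" and v
    by (rule bond_unitaries_cohomology[OF \<open>1 \<le> L\<close> T _ _ _ _ that])
      (assumption | rule assms(5) assms(8) assms(9) assms(10))+
  \<comment> \<open>The nonexistence claim is proved by contraposition: a symmetric injective MPS
    has bond unitaries, and their classes solve both relations.\<close>
  have mps_classes: "\<exists>c. (\<forall>j\<in>{0..int L}. c j \<in> carrier (H2 G)) \<and>
          (\<forall>j\<in>{1..int L}.
            c j = H2_class G (\<nu> j) \<otimes>\<^bsub>H2 G\<^esub> c (j - 1) \<and>
            c j = H2_pullback G T (c (j - 1)))"
    if A: "left_canonical_injective A" and sym: "symmetric_mps G L U A" for A :: "('d, 'b) mps"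
  proof -
    obtain v where "bond_unitaries G L U A v"
      using symmetric_mps_bond_unitaries[OF A \<open>1 \<le> L\<close> assms(7) sym] by blast
    with cohomology[OF A] obtain \<omega> where coc: "\<forall>j\<in>{0..int L}. two_cocycle G (\<omega> j)"
      and rel: "\<forall>j\<in>{1..int L}.
        H2_class G (\<omega> j) = H2_class G (\<nu> j) \<otimes>\<^bsub>H2 G\<^esub> H2_class G (\<omega> (j - 1)) \<and>
        H2_class G (\<omega> j) = H2_class G (pullback2 T (\<omega> (j - 1)))"
      by blast
    have "H2_pullback G T (H2_class G (\<omega> (j - 1))) = H2_class G (pullback2 T (\<omega> (j - 1)))"
      if "j \<in> {1..int L}" for j
      using that coc by (intro H2_pullback_class[OF T]) auto
    then show ?thesis
      using coc rel H2_class_carrier by (intro exI[of _ "\<lambda>j. H2_class G (\<omega> j)"]) auto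
  qed
  show ?thesis
  proof (intro conjI allI impI, goal_cases)
    case (1 A v)
    then show ?case by (intro cohomology) auto
  next
    case 2
    then show ?case using mps_classes by metis
  qed
qed

end
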